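(* Let $E$ be an elementary abelian $2$-group, $R=Q_8\times E$, $n=|R|$, and $B=\langle R,\alpha_i,\alpha_j,\alpha_k\rangle\le\mathrm{Sym}(R)$. Then $R\cong Q_8\times C_2^\ell$ for some $\ell$, $R$ has $2^{5n/8}$ inverse-closed subsets, and the number of inverse-closed subsets $S$ of $R$ with $\mathrm{Aut}(\mathrm{Cay}(R,S))>B$ (strict containment) is at most $2^{5n/8}\cdot\varepsilon$, where $$\varepsilon=2^{-n/512+(\log_2(n))^2+2}.$$
   Context: All groups and graphs are finite; graphs are undirected without multiple edges, may have loops and may be disconnected. $C_2$ is the cyclic group of order $2$. For a group $R$ and an inverse-closed subset $S\subseteq R$ ($S=S^{-1}$), $\mathrm{Cay}(R,S)$ is the graph with vertex-set $R$ in which $\{g,h\}$ is an edge if and only if $gh^{-1}\in S$. $R$ is identified with the subgroup of $\mathrm{Sym}(R)$ given by right multiplication. $Q_8=\langle i,j\mid i^4=1,\ i^2=j^2,\ i^j=i^{-1}\rangle$ is the quaternion group with elements labelled $\{1,-1,i,-i,j,-j,k,-k\}$ in the usual way. For $t\in\{i,j,k\}$, $\alpha_t$ is the permutation of $R=Q_8\times E$ that swaps $te$ and $-te$ for every $e\in E$ and fixes every other element of $R$. *)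

theory Defs
  imports Complex_Main "HOL-Algebra.Algebra"
begin

datatype quat_unit = U1 | UI | UJ | UK

text \<open>An element of the quaternion group is a pair \<open>(s, u)\<close>, read as \<open>u\<close> if \<open>s = False\<close>
  and as \<open>-u\<close> if \<open>s = True\<close>.\<close>

type_synonym quat = "bool \<times> quat_unit"

fun unit_mult :: "quat_unit \<Rightarrow> quat_unit \<Rightarrow> quat" where
  "unit_mult U1 v = (False, v)"
| "unit_mult u U1 = (False, u)"
| "unit_mult UI UI = (True, U1)"
| "unit_mult UI UJ = (False, UK)"
| "unit_mult UI UK = (True, UJ)"
| "unit_mult UJ UI = (True, UK)"
| "unit_mult UJ UJ = (True, U1)"
| "unit_mult UJ UK = (False, UI)"
| "unit_mult UK UI = (False, UJ)"
| "unit_mult UK UJ = (True, UI)"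
| "unit_mult UK UK = (True, U1)"

fun quat_mult :: "quat \<Rightarrow> quat \<Rightarrow> quat" where
  "quat_mult (s, u) (t, v) =
     ((s \<noteq> t) \<noteq> fst (unit_mult u v), snd (unit_mult u v))"

definition quat_neg :: "quat \<Rightarrow> quat" where
  "quat_neg q = (\<not> fst q, snd q)"

definition quat_i :: quat where "quat_i = (False, UI)"
definition quat_j :: quat where "quat_j = (False, UJ)"
definition quat_k :: quat where "quat_k = (False, UK)"

definition Q8 :: "quat monoid" where
  "Q8 = \<lparr>carrier = UNIV, monoid.mult = quat_mult, one = (False, U1)\<rparr>"

text \<open>\<open>Q8\<close> is a group of order 8 generated by \<open>i\<close> and \<open>j\<close> and satisfying the relations
  \<open>i^4 = 1\<close>, \<open>i^2 = j^2\<close>, \<open>j\<inverse> i j = i\<inverse>\<close>.  The group presented by these relations has order 8,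
  so \<open>Q8\<close> realises the presentation.\<close>

lemma quat_mult_assoc: "quat_mult (quat_mult x y) z = quat_mult x (quat_mult y z)"
proof -
  obtain a u b v c w where "x = (a, u)" "y = (b, v)" "z = (c, w)"
    by (metis surj_pair)
  then show ?thesis
    by (cases u; cases v; cases w; simp) auto
qed

lemma group_Q8: "group Q8"
proof (rule groupI)
  fix x y z assume "x \<in> carrier Q8" "y \<in> carrier Q8" "z \<in> carrier Q8"
  show "x \<otimes>\<^bsub>Q8\<^esub> y \<otimes>\<^bsub>Q8\<^esub> z = x \<otimes>\<^bsub>Q8\<^esub> (y \<otimes>\<^bsub>Q8\<^esub> z)"
    by (simp add: Q8_def quat_mult_assoc)
next
  fix x assume "x \<in> carrier Q8"
  obtain a u where x: "x = (a, u)" by (metis surj_pair)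
  have "quat_mult (if u = U1 then a else \<not> a, u) x = (False, U1)"
    unfolding x by (cases u) auto
  then show "\<exists>y\<in>carrier Q8. y \<otimes>\<^bsub>Q8\<^esub> x = \<one>\<^bsub>Q8\<^esub>"
    by (auto simp add: Q8_def)
next
  fix x :: quat
  show "\<one>\<^bsub>Q8\<^esub> \<otimes>\<^bsub>Q8\<^esub> x = x"
    by (cases x) (simp add: Q8_def)
qed (auto simp: Q8_def)

lemma UNIV_quat_unit: "UNIV = {U1, UI, UJ, UK}"
  using quat_unit.exhaust by auto

lemma order_Q8: "order Q8 = 8"
proof -
  have "card (UNIV :: quat set) = card (UNIV :: bool set) * card (UNIV :: quat_unit set)"
    by (metis UNIV_Times_UNIV card_cartesian_product)
  then show ?thesis
    by (simp add: order_def Q8_def UNIV_quat_unit)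
qed

lemma Q8_relations:
  "quat_i [^]\<^bsub>Q8\<^esub> (4::nat) = \<one>\<^bsub>Q8\<^esub>"
  "quat_i [^]\<^bsub>Q8\<^esub> (2::nat) = quat_j [^]\<^bsub>Q8\<^esub> (2::nat)"
  "inv\<^bsub>Q8\<^esub> quat_j \<otimes>\<^bsub>Q8\<^esub> quat_i \<otimes>\<^bsub>Q8\<^esub> quat_j = inv\<^bsub>Q8\<^esub> quat_i"
  "quat_i \<otimes>\<^bsub>Q8\<^esub> quat_j = quat_k"
proof -
  interpret group Q8 by (rule group_Q8)
  have ii: "inv\<^bsub>Q8\<^esub> quat_i = (True, UI)"
    by (rule inv_equality) (auto simp: Q8_def quat_i_def)
  have ij: "inv\<^bsub>Q8\<^esub> quat_j = (True, UJ)"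
    by (rule inv_equality) (auto simp: Q8_def quat_j_def)
  show "inv\<^bsub>Q8\<^esub> quat_j \<otimes>\<^bsub>Q8\<^esub> quat_i \<otimes>\<^bsub>Q8\<^esub> quat_j = inv\<^bsub>Q8\<^esub> quat_i"
    unfolding ii ij by (simp add: Q8_def quat_i_def quat_j_def)
qed (simp_all add: Q8_def quat_i_def quat_j_def quat_k_def numeral_eq_Suc)

lemma generate_Q8: "generate Q8 {quat_i, quat_j} = carrier Q8"
proof -
  let ?H = "generate Q8 {quat_i, quat_j}"
  have m: "quat_mult x y \<in> ?H" if "x \<in> ?H" "y \<in> ?H" for x y
    using generate.eng[OF that] by (simp add: Q8_def)
  have i: "(False, UI) \<in> ?H" and j: "(False, UJ) \<in> ?H"
    by (auto intro!: generate.incl simp: quat_i_def quat_j_def)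
  have k: "(False, UK) \<in> ?H" using m[OF i j] by simp
  have m1: "(True, U1) \<in> ?H" using m[OF i i] by simp
  have p1: "(False, U1) \<in> ?H" using generate.one[of Q8] by (simp add: Q8_def)
  have mi: "(True, UI) \<in> ?H" "(True, UJ) \<in> ?H" "(True, UK) \<in> ?H"
    using m[OF m1 i] m[OF m1 j] m[OF m1 k] by simp_all
  have "(s, u) \<in> ?H" for s u
    using i j k m1 p1 mi by (cases s; cases u) auto
  then show ?thesis by (auto simp: Q8_def)
qed

definition elementary_abelian_2_group :: "('a, 'b) monoid_scheme \<Rightarrow> bool" where
  "elementary_abelian_2_group E \<longleftrightarrow>
     comm_group E \<and> finite (carrier E) \<and> (\<forall>x\<in>carrier E. x \<otimes>\<^bsub>E\<^esub> x = \<one>\<^bsub>E\<^esub>)"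

definition inverse_closed :: "('a, 'b) monoid_scheme \<Rightarrow> 'a set \<Rightarrow> bool" where
  "inverse_closed R S \<longleftrightarrow> S \<subseteq> carrier R \<and> (\<lambda>x. inv\<^bsub>R\<^esub> x) ` S = S"

text \<open>A graph is a pair of a vertex set and a set of edges \<open>{x, y}\<close>; a loop is an edge \<open>{x}\<close>.\<close>

type_synonym 'a ugraph = "'a set \<times> 'a set set"

definition Cay :: "('a, 'b) monoid_scheme \<Rightarrow> 'a set \<Rightarrow> 'a ugraph" where
  "Cay R S =
     (carrier R, {{g, h} |g h. g \<in> carrier R \<and> h \<in> carrier R \<and> g \<otimes>\<^bsub>R\<^esub> inv\<^bsub>R\<^esub> h \<in> S})"

text \<open>Permutations of \<open>V\<close> are represented, as in \<open>BijGroup V\<close>, by functions that are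
  \<open>undefined\<close> outside \<open>V\<close>, so that sets of permutations may be compared by inclusion.\<close>

definition Aut :: "'a ugraph \<Rightarrow> ('a \<Rightarrow> 'a) set" where
  "Aut \<Gamma> = {f \<in> Bij (fst \<Gamma>).
     \<forall>x\<in>fst \<Gamma>. \<forall>y\<in>fst \<Gamma>. {f x, f y} \<in> snd \<Gamma> \<longleftrightarrow> {x, y} \<in> snd \<Gamma>}"

definition right_regular :: "('a, 'b) monoid_scheme \<Rightarrow> ('a \<Rightarrow> 'a) set" where
  "right_regular R = (\<lambda>g. \<lambda>x\<in>carrier R. x \<otimes>\<^bsub>R\<^esub> g) ` carrier R"

definition alpha :: "('a, 'b) monoid_scheme \<Rightarrow> quat \<Rightarrow> quat \<times> 'a \<Rightarrow> quat \<times> 'a" where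
  "alpha E t = (\<lambda>(q, e) \<in> carrier (Q8 \<times>\<times> E).
     if q = t then (quat_neg t, e) else if q = quat_neg t then (t, e) else (q, e))"

text \<open>\<open>BijGroup\<close> composes permutations from right to left; the generated set of permutations
  is the same for the opposite convention.\<close>

definition Bgrp :: "('a, 'b) monoid_scheme \<Rightarrow> (quat \<times> 'a \<Rightarrow> quat \<times> 'a) set" where
  "Bgrp E = generate (BijGroup (carrier (Q8 \<times>\<times> E)))
     (right_regular (Q8 \<times>\<times> E) \<union> {alpha E quat_i, alpha E quat_j, alpha E quat_k})"

end

theory Submission
  imports Defs
begin

text \<open>
  Write \<open>Z\<close> for the centre \<open>{1, -1} \<times> E\<close> of \<open>R\<close>, an elementary abelian 2-group of index 4, and
  \<open>M\<close> for the order of \<open>E\<close>, so that \<open>n = 8 M\<close>.  Every element outside \<open>Z\<close> has order 4 and its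
  inverse is its negative.  An inverse-closed set is therefore an arbitrary subset of \<open>Z\<close> together
  with an arbitrary set of pairs \<open>{x, -x}\<close> outside \<open>Z\<close>: there are \<open>2 M + 3 M = 5 n / 8\<close> free
  choices.  In the Cayley graph, each of the four cosets of \<open>Z\<close> carries a copy of
  \<open>Cay(Z, S \<inter> Z)\<close>, and between two different cosets adjacency ignores signs.

  Five properties of \<open>S\<close>, gathered below in \<open>separated\<close>, \<open>linked\<close>, \<open>rigid\<close> and \<open>aperiodic\<close>,
  force every automorphism \<open>\<phi>\<close> into \<open>B\<close> (\<open>Aut_subset_Bgrp\<close>).
  The vertices \<open>x\<close> and \<open>-x\<close> have the same neighbours outside their own coset of \<open>Z\<close>, so their
  neighbourhoods differ in at most \<open>2 M\<close> vertices.  If all other pairs differ in more, \<open>\<phi>\<close>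
  commutes with negation.  It then preserves the relation ``\<open>y\<close> and \<open>-y\<close> are joined to \<open>x\<close>
  differently'', which only relates vertices of one coset; if every coset is connected
  by this relation in two steps, \<open>\<phi>\<close> permutes the cosets.  On each coset it induces an
  automorphism of \<open>Cay(Z, S \<inter> Z)\<close>, up to identifying the cosets with \<open>Z\<close>.  If no non-trivial
  group automorphism of \<open>Z\<close> fixes \<open>S \<inter> Z\<close>, then all these maps are translations.  Finally, if
  the three sets that govern adjacency between cosets have no periods and none is a translate
  of another, then the four translations agree up to sign and the cosets are permuted as by an
  element of \<open>R\<close>; such a \<open>\<phi>\<close> is a right multiplication after sign changes on whole
  cosets, and these generate \<open>B\<close>.

  The step from ``no group automorphism'' to ``only translations'' is \<open>regular_if_no_additive\<close>.
  A stabiliser in a group of permutations of \<open>Z\<close> that contains the translations carries commuting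
  involutions, indexed by \<open>Z\<close>, whose common fixed points are the additive maps.  Counting modulo 2
  leaves only the identity, and this determines the orbits of the stabiliser.

  Each way of violating one of the properties prescribes, for a large family of pairs of
  free choices, that few of them disagree, or a similar pattern; it holds for a proportion of at most
  \<open>2^(-M/64) = 2^(-n/512)\<close> of all sets \<open>S\<close>.  There are at most \<open>2^((log n)^2 + 2)\<close> ways, the
  dominant part being the additive permutations of \<open>Z\<close>, of which there are at most
  \<open>2^((log (n/4))^2)\<close>.  The union bound (\<open>card_exceptional_le\<close>) concludes.
\<close>

section \<open>Permutation groups containing the translations of an elementary abelian 2-group\<close>

lemma card_parity_involution:
  assumes "finite Y" "\<And>y. y \<in> Y \<Longrightarrow> a y \<in> Y" "\<And>y. y \<in> Y \<Longrightarrow> a (a y) = y"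
  shows "even (card Y) \<longleftrightarrow> even (card {y \<in> Y. a y = y})"
  using assms
proof (induction Y rule: finite_psubset_induct)
  case (psubset Y)
  show ?case
  proof (cases "\<exists>y\<in>Y. a y \<noteq> y")
    case False
    then have "{y \<in> Y. a y = y} = Y" by auto
    then show ?thesis by simp
  next
    case True
    then obtain y where y: "y \<in> Y" "a y \<noteq> y" by blast
    let ?Y = "Y - {y, a y}"
    have ay: "a y \<in> Y" "a (a y) = y" using y psubset.prems by auto
    have "even (card ?Y) \<longleftrightarrow> even (card {z \<in> ?Y. a z = z})"
    proof (rule psubset.IH)
      show "?Y \<subset> Y" using y by auto
      show "a z \<in> ?Y" if "z \<in> ?Y" for z
        using that psubset.prems ay by (metis Diff_iff insert_iff singletonD)
      show "a (a z) = z" if "z \<in> ?Y" for z using that psubset.prems by auto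
    qed
    moreover have "{z \<in> ?Y. a z = z} = {z \<in> Y. a z = z}" using y ay by auto
    moreover have "card Y = card ?Y + 2"
    proof -
      have "card {y, a y} = 2" using y by simp
      moreover have "card {y, a y} \<le> card Y" using y ay psubset.hyps by (intro card_mono) auto
      ultimately show ?thesis using y ay psubset.hyps by (subst card_Diff_subset) auto
    qed
    ultimately show ?thesis by simp
  qed
qed

lemma card_parity_commuting_involutions:
  assumes "finite C" "finite Y"
    and "\<And>c y. c \<in> C \<Longrightarrow> y \<in> Y \<Longrightarrow> a c y \<in> Y"
    and "\<And>c y. c \<in> C \<Longrightarrow> y \<in> Y \<Longrightarrow> a c (a c y) = y"
    and "\<And>c d y. c \<in> C \<Longrightarrow> d \<in> C \<Longrightarrow> y \<in> Y \<Longrightarrow> a c (a d y) = a d (a c y)"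
  shows "even (card Y) \<longleftrightarrow> even (card {y \<in> Y. \<forall>c\<in>C. a c y = y})"
  using assms
proof (induction C rule: finite_induct)
  case empty
  then show ?case by simp
next
  case (insert c C)
  let ?F = "{y \<in> Y. \<forall>c\<in>C. a c y = y}"
  have "even (card Y) \<longleftrightarrow> even (card ?F)"
    by (rule insert.IH) (use insert.prems in auto)
  also have "\<dots> \<longleftrightarrow> even (card {y \<in> ?F. a c y = y})"
  proof (rule card_parity_involution)
    show "finite ?F" using insert.prems by auto
    show "a c y \<in> ?F" if "y \<in> ?F" for y
    proof -
      have "a d (a c y) = a c y" if "d \<in> C" for d
        using insert.prems(4)[of d c y] that \<open>y \<in> ?F\<close> by auto
      then show ?thesis using that insert.prems(2) by auto
    qed
    show "a c (a c y) = y" if "y \<in> ?F" for y using that insert.prems by auto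
  qed
  also have "{y \<in> ?F. a c y = y} = {y \<in> Y. \<forall>c\<in>insert c C. a c y = y}" by auto
  finally show ?case .
qed

locale elem2 = comm_group V for V (structure) +
  assumes fin: "finite (carrier V)"
    and sq: "x \<in> carrier V \<Longrightarrow> x \<otimes> x = \<one>"
begin

lemma cancel2 [simp]: "x \<in> carrier V \<Longrightarrow> y \<in> carrier V \<Longrightarrow> x \<otimes> (x \<otimes> y) = y"
  by (simp add: m_assoc [symmetric] sq)

lemma cancel2' [simp]: "x \<in> carrier V \<Longrightarrow> y \<in> carrier V \<Longrightarrow> x \<otimes> (y \<otimes> x) = y"
  using cancel2 m_comm by auto

lemma inv_self [simp]: "x \<in> carrier V \<Longrightarrow> inv x = x"
  by (simp add: inv_equality sq)

lemma mult_eq_one_iff: "x \<in> carrier V \<Longrightarrow> y \<in> carrier V \<Longrightarrow> x \<otimes> y = \<one> \<longleftrightarrow> x = y"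
  by (metis sq cancel2 r_one)

definition translation :: "'a \<Rightarrow> 'a \<Rightarrow> 'a" where
  "translation z = (\<lambda>x. if x \<in> carrier V then z \<otimes> x else x)"

definition additive :: "('a \<Rightarrow> 'a) \<Rightarrow> bool" where
  "additive g \<longleftrightarrow> (\<forall>x\<in>carrier V. \<forall>y\<in>carrier V. g (x \<otimes> y) = g x \<otimes> g y)"

lemma translation_permutes: "z \<in> carrier V \<Longrightarrow> translation z permutes carrier V"
  by (rule bij_imp_permutes, rule bij_betw_byWitness[where f' = "translation z"])
    (auto simp: translation_def)

text \<open>
  For \<open>h\<close> in the stabiliser of \<open>\<one>\<close> and \<open>z \<in> V\<close> put \<open>(z \<cdot> h) x = h z \<otimes> h (z \<otimes> x)\<close>; this is again
  in the stabiliser, being \<open>h\<close> composed with two translations.  It defines an action of \<open>V\<close> by commuting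
  involutions, and \<open>z\<close> fixes \<open>h\<close> exactly if \<open>h (z \<otimes> x) = h z \<otimes> h x\<close> for all \<open>x\<close>.  Given \<open>x\<close>
  and \<open>w\<close>, count the \<open>h\<close> with \<open>h x = w\<close> modulo 2.  The involution of \<open>x\<close> preserves
  this set, and the whole of \<open>V\<close> preserves the set of its fixed points, so only additive \<open>h\<close>, that is
  the identity, contribute: the number is odd exactly if \<open>w = x\<close>.  For \<open>k\<close> in the stabiliser,
  \<open>h \<mapsto> h \<circ> k\<close> shows that as many \<open>h\<close> send \<open>k x\<close> to \<open>x\<close> as send \<open>x\<close> to \<open>x\<close>; hence
  \<open>k x = x\<close>.
\<close>
theorem regular_if_no_additive:
  assumes perm: "\<And>g. g \<in> A \<Longrightarrow> g permutes carrier V"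
    and comp: "\<And>g h. g \<in> A \<Longrightarrow> h \<in> A \<Longrightarrow> g \<circ> h \<in> A"
    and trans_mem: "\<And>z. z \<in> carrier V \<Longrightarrow> translation z \<in> A"
    and no_add: "\<And>g. g \<in> A \<Longrightarrow> additive g \<Longrightarrow> g = id"
    and g: "g \<in> A"
  shows "g = translation (g \<one>)"
proof -
  let ?C = "carrier V"
  define A1 where "A1 = {h \<in> A. h \<one> = \<one>}"
  define act where "act z h = translation (h z) \<circ> h \<circ> translation z" for z h
  have "A \<subseteq> {p. p permutes ?C}" using perm by auto
  then have finA: "finite A" using fin finite_permutations finite_subset by blast
  have cl: "h x \<in> ?C" if "h \<in> A" "x \<in> ?C" for h x
    using perm[OF that(1)] that(2) by (simp add: permutes_in_image)
  have eqI: "h = h'" if "h \<in> A" "h' \<in> A" "\<And>x. x \<in> ?C \<Longrightarrow> h x = h' x" for h h'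
    using that perm by (metis ext permutes_not_in)
  have act_apply: "act z h x = h z \<otimes> h (z \<otimes> x)"
    if "z \<in> ?C" "h \<in> A" "x \<in> ?C" for z h x
    using that cl by (simp add: act_def translation_def)
  have act_mem: "act z h \<in> A" if "z \<in> ?C" "h \<in> A" for z h
    unfolding act_def using comp[OF comp[OF trans_mem[OF cl[OF that(2,1)]] that(2)] trans_mem[OF that(1)]] .
  have act_A1: "act z h \<in> A1" if "z \<in> ?C" "h \<in> A1" for z h
    using that act_mem[of z h] cl by (simp add: A1_def act_apply sq)
  have act_act: "act w (act z h) = act (z \<otimes> w) h"
    if "z \<in> ?C" "w \<in> ?C" "h \<in> A1" for z w h
  proof (rule eqI)
    have hA: "h \<in> A" using that by (auto simp: A1_def)
    show "act w (act z h) \<in> A" "act (z \<otimes> w) h \<in> A" using that hA act_mem by auto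
    fix x assume x: "x \<in> ?C"
    have "act w (act z h) x = (h z \<otimes> h (z \<otimes> w)) \<otimes> (h z \<otimes> h (z \<otimes> (w \<otimes> x)))"
      using that hA x act_mem by (simp add: act_apply)
    also have "\<dots> = h (z \<otimes> w) \<otimes> h (z \<otimes> w \<otimes> x)"
      using that hA x cl by (simp add: m_ac)
    finally show "act w (act z h) x = act (z \<otimes> w) h x"
      using that hA x by (simp add: act_apply)
  qed
  have act_one: "act \<one> h = h" if "h \<in> A1" for h
  proof (rule eqI)
    show "act \<one> h \<in> A" "h \<in> A" using that act_mem by (auto simp: A1_def)
    show "act \<one> h x = h x" if "x \<in> ?C" for x
      using that \<open>h \<in> A1\<close> cl by (simp add: act_apply A1_def)
  qed
  have act_fixed_iff: "act z h = h \<longleftrightarrow> (\<forall>x\<in>?C. h (z \<otimes> x) = h z \<otimes> h x)"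
    if "z \<in> ?C" "h \<in> A1" for z h
  proof
    have hA: "h \<in> A" using that by (auto simp: A1_def)
    show "\<forall>x\<in>?C. h (z \<otimes> x) = h z \<otimes> h x" if "act z h = h"
    proof
      fix x assume x: "x \<in> ?C"
      have "h x = h z \<otimes> h (z \<otimes> x)" using act_apply[of z h x] that hA x \<open>z \<in> ?C\<close> by simp
      then show "h (z \<otimes> x) = h z \<otimes> h x" using cl hA x \<open>z \<in> ?C\<close> by simp
    qed
    show "act z h = h" if "\<forall>x\<in>?C. h (z \<otimes> x) = h z \<otimes> h x"
    proof (rule eqI)
      show "act z h \<in> A" "h \<in> A" using hA act_mem \<open>z \<in> ?C\<close> by auto
      show "act z h x = h x" if "x \<in> ?C" for x
        using that \<open>\<forall>x\<in>?C. h (z \<otimes> x) = h z \<otimes> h x\<close> \<open>z \<in> ?C\<close> hA cl by (simp add: act_apply)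
    qed
  qed
  have finA1: "finite A1" using finA by (simp add: A1_def)
  have id_A1: "id \<in> A1"
  proof -
    have "translation \<one> = id" by (auto simp: translation_def)
    then show ?thesis using trans_mem[of "\<one>"] by (simp add: A1_def)
  qed
  \<comment> \<open>The first count uses the involution of \<open>x\<close> alone, the second one all of \<open>V\<close> on its fixed points.\<close>
  have parity: "odd (card {h \<in> A1. h x = w}) \<longleftrightarrow> w = x" if x: "x \<in> ?C" and w: "w \<in> ?C" for x w
  proof -
    let ?Y = "{h \<in> A1. h x = w}"
    let ?F = "{h \<in> ?Y. act x h = h}"
    have "even (card ?Y) \<longleftrightarrow> even (card ?F)"
    proof (rule card_parity_involution)
      show "finite ?Y" using finA1 by simp
      show "act x h \<in> ?Y" if "h \<in> ?Y" for h
        using that x act_A1[of x h] act_apply[of x h x] w by (simp add: A1_def sq)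
      show "act x (act x h) = h" if "h \<in> ?Y" for h
        using that x act_act[of x x h] act_one[of h] by (simp add: sq)
    qed
    also have "\<dots> \<longleftrightarrow> even (card {h \<in> ?F. \<forall>z\<in>?C. act z h = h})"
    proof (rule card_parity_commuting_involutions)
      show "finite ?C" "finite ?F" using fin finA1 by simp_all
      show "act z (act z h) = h" if "z \<in> ?C" "h \<in> ?F" for z h
        using that act_act[of z z h] act_one[of h] by (simp add: sq)
      show "act z (act v h) = act v (act z h)" if "z \<in> ?C" "v \<in> ?C" "h \<in> ?F" for z v h
        using that act_act by (simp add: m_comm)
      show "act z h \<in> ?F" if "z \<in> ?C" "h \<in> ?F" for z h
      proof -
        have h: "h \<in> A1" "h \<in> A" "h x = w" "act x h = h" using that by (auto simp: A1_def)
        have "act x (act z h) = act z (act x h)"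
          using act_act[OF that(1) x h(1)] act_act[OF x that(1) h(1)] m_comm[OF that(1) x] by simp
        moreover have "act z h x = w"
        proof -
          have "act z h x = h z \<otimes> h (x \<otimes> z)" using h that x by (simp add: act_apply m_comm)
          also have "\<dots> = h z \<otimes> (h x \<otimes> h z)" using act_fixed_iff[of x h] h that x by simp
          finally show ?thesis using h cl that w by simp
        qed
        ultimately show ?thesis using h that act_A1 by simp
      qed
    qed
    also have "{h \<in> ?F. \<forall>z\<in>?C. act z h = h} = (if w = x then {id} else {})"
    proof -
      have "act z id = id" if "z \<in> ?C" for z
        using act_fixed_iff[OF that id_A1] by simp
      moreover have "h = id" if "h \<in> A1" "\<forall>z\<in>?C. act z h = h" for h
        using that act_fixed_iff no_add[of h] by (auto simp: A1_def additive_def)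
      ultimately have fix_iff: "(\<forall>z\<in>?C. act z h = h) = (h = id)" if "h \<in> A1" for h
        using that by blast
      have F: "{h \<in> ?F. \<forall>z\<in>?C. act z h = h} = {h \<in> A1. h x = w \<and> h = id}"
      proof (intro subset_antisym subsetI)
        fix h assume h: "h \<in> {h \<in> ?F. \<forall>z\<in>?C. act z h = h}"
        then have "h \<in> A1" "h x = w" "\<forall>z\<in>?C. act z h = h" by simp_all
        with fix_iff show "h \<in> {h \<in> A1. h x = w \<and> h = id}" by simp
      next
        fix h assume h: "h \<in> {h \<in> A1. h x = w \<and> h = id}"
        then have h1: "h \<in> A1" "h x = w" and "h = id" by blast+
        then have fixed: "\<forall>z\<in>?C. act z h = h" using fix_iff by blast
        then have "act x h = h" using x by blast
        with h1 fixed show "h \<in> {h \<in> ?F. \<forall>z\<in>?C. act z h = h}" by simp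
      qed
      have "{h \<in> A1. h x = w \<and> h = id} = (if w = x then {id} else {})"
      proof (cases "w = x")
        case True
        then have "h \<in> A1 \<and> h x = w \<and> h = id \<longleftrightarrow> h = id" for h
          using id_A1 by (metis id_apply)
        then show ?thesis using True by simp
      next
        case False
        then show ?thesis by fastforce
      qed
      with F show ?thesis by (rule trans)
    qed
    finally show ?thesis by auto
  qed
  have A1_id: "k = id" if k: "k \<in> A1" for k
  proof (rule eqI)
    have kA: "k \<in> A" using k by (simp add: A1_def)
    then show "k \<in> A" "id \<in> A" using id_A1 by (auto simp: A1_def)
    fix x assume x: "x \<in> ?C"
    have kx: "k x \<in> ?C" using cl kA x by blast
    have inj: "inj_on (\<lambda>h. h \<circ> k) A1"
    proof (rule inj_onI)
      fix h h' assume "h \<circ> k = h' \<circ> k"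
      then show "h = h'" using permutes_surj[OF perm[OF kA]] by (metis surj_fun_eq)
    qed
    have surj: "(\<lambda>h. h \<circ> k) ` A1 = A1"
      by (rule endo_inj_surj[OF finA1 _ inj]) (use comp kA k in \<open>auto simp: A1_def\<close>)
    have "{h \<in> A1. h x = x} = (\<lambda>h. h \<circ> k) ` {h \<in> A1. h (k x) = x}" (is "?L = ?R")
    proof
      show "?R \<subseteq> ?L" using comp kA k by (auto simp: A1_def)
      show "?L \<subseteq> ?R"
      proof
        fix h assume h: "h \<in> ?L"
        then obtain h' where "h' \<in> A1" "h = h' \<circ> k" using surj by blast
        then show "h \<in> ?R" using h by auto
      qed
    qed
    moreover have "inj_on (\<lambda>h. h \<circ> k) {h \<in> A1. h (k x) = x}"
      using inj by (rule inj_on_subset) auto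
    ultimately have "card {h \<in> A1. h x = x} = card {h \<in> A1. h (k x) = x}"
      by (simp add: card_image)
    moreover have "odd (card {h \<in> A1. h x = x})" using parity[OF x x] by blast
    ultimately have "odd (card {h \<in> A1. h (k x) = x})" by metis
    then have "x = k x" using parity[OF kx x] by blast
    then show "k x = id x" by simp
  qed
  let ?k = "translation (g \<one>) \<circ> g"
  have g1: "g \<one> \<in> ?C" using g cl by blast
  have "?k \<in> A1" unfolding A1_def using comp[OF trans_mem[OF g1] g] g1 by (simp add: translation_def sq)
  then have k: "?k = id" by (rule A1_id)
  show ?thesis
  proof (rule eqI)
    show "g \<in> A" "translation (g \<one>) \<in> A" using g g1 trans_mem by auto
    fix x assume x: "x \<in> ?C"
    have "?k x = x" using k by simp
    then have "g \<one> \<otimes> g x = x" using x cl g by (simp add: translation_def)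
    moreover have "g \<one> \<otimes> (g \<one> \<otimes> g x) = g x" by (rule cancel2[OF g1 cl[OF g x]])
    ultimately show "g x = translation (g \<one>) x" using x by (simp add: translation_def)
  qed
qed

end

lemma elem2_iff: "elementary_abelian_2_group E \<longleftrightarrow> elem2 E"
  by (auto simp: elementary_abelian_2_group_def elem2_def elem2_axioms_def)

section \<open>Bases, and the number of additive permutations\<close>

context elem2 begin

text \<open>
  The linear combination of \<open>b 0, \<dots>, b (l - 1)\<close> with coefficients \<open>f\<close>.  The coefficients are
  integers so that \<open>comb b l\<close> is a homomorphism from the product of copies of
  \<open>integer_mod_group 2\<close> itself.
\<close>
definition comb :: "(nat \<Rightarrow> 'a) \<Rightarrow> nat \<Rightarrow> (nat \<Rightarrow> int) \<Rightarrow> 'a" where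
  "comb b l f = (\<Otimes>i\<in>{..<l}. if f i = 1 then b i else \<one>)"

abbreviation bits :: "nat \<Rightarrow> (nat \<Rightarrow> int) monoid" where
  "bits l \<equiv> product_group {..<l} (\<lambda>_. integer_mod_group 2)"

lemma carrier_bits: "carrier (bits l) = {..<l} \<rightarrow>\<^sub>E {0, 1}"
proof -
  have "{0..<2::int} = {0, 1}" by auto
  then show ?thesis by (simp add: carrier_integer_mod_group)
qed

lemma comb_closed [simp]: "b \<in> {..<l} \<rightarrow> carrier V \<Longrightarrow> comb b l f \<in> carrier V"
  unfolding comb_def by (rule finprod_closed) auto

lemma comb_Suc:
  assumes "b \<in> {..<Suc l} \<rightarrow> carrier V"
  shows "comb b (Suc l) f = (if f l = 1 then b l else \<one>) \<otimes> comb b l f"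
proof -
  have "comb b (Suc l) f = (\<Otimes>i\<in>insert l {..<l}. if f i = 1 then b i else \<one>)"
    by (simp add: comb_def lessThan_Suc)
  also have "\<dots> = (if f l = 1 then b l else \<one>) \<otimes> comb b l f"
    unfolding comb_def by (subst finprod_insert) (use assms in auto)
  finally show ?thesis .
qed

lemma comb_cong: "(\<And>i. i < l \<Longrightarrow> b i = b' i) \<Longrightarrow> (\<And>i. i < l \<Longrightarrow> f i = f' i) \<Longrightarrow>
    b' \<in> {..<l} \<rightarrow> carrier V \<Longrightarrow> comb b l f = comb b' l f'"
  unfolding comb_def by (rule finprod_cong') auto

lemma comb_hom:
  assumes b: "b \<in> {..<l} \<rightarrow> carrier V"
  shows "comb b l \<in> hom (bits l) V"
proof (rule homI)
  show "comb b l f \<in> carrier V" for f using b by simp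
  fix f g assume fg: "f \<in> carrier (bits l)" "g \<in> carrier (bits l)"
  have val: "(f i = 0 \<or> f i = 1) \<and> (g i = 0 \<or> g i = 1)" if "i < l" for i
    using fg that unfolding carrier_bits PiE_def Pi_def by blast
  have "comb b l f \<otimes> comb b l g
      = (\<Otimes>i\<in>{..<l}. (if f i = 1 then b i else \<one>) \<otimes> (if g i = 1 then b i else \<one>))"
    unfolding comb_def by (rule finprod_multf [symmetric]) (use b in auto)
  also have "\<dots> = comb b l (f \<otimes>\<^bsub>bits l\<^esub> g)"
    unfolding comb_def
  proof (rule finprod_cong')
    show "(if f i = 1 then b i else \<one>) \<otimes> (if g i = 1 then b i else \<one>)
        = (if (f \<otimes>\<^bsub>bits l\<^esub> g) i = 1 then b i else \<one>)" if "i \<in> {..<l}" for i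
      using that val[of i] funcset_mem[OF b, of i] by (auto simp: sq)
  qed (use b in auto)
  finally show "comb b l (f \<otimes>\<^bsub>bits l\<^esub> g) = comb b l f \<otimes> comb b l g" ..
qed

lemma card_bits: "card (carrier (bits l)) = 2 ^ l"
  unfolding carrier_bits by (simp add: card_PiE numeral_2_eq_2)

text \<open>
  The image of an independent family is a subgroup, so adjoining an element outside it cannot create
  a relation that involves the new element.
\<close>
lemma inj_comb_Suc:
  assumes b: "b \<in> {..<l} \<rightarrow> carrier V"
    and inj: "inj_on (comb b l) (carrier (bits l))"
    and y: "y \<in> carrier V" "y \<notin> comb b l ` carrier (bits l)"
  shows "inj_on (comb (b(l := y)) (Suc l)) (carrier (bits (Suc l)))"
proof (rule inj_onI)
  let ?b = "b(l := y)"
  fix f g assume f: "f \<in> carrier (bits (Suc l))" and g: "g \<in> carrier (bits (Suc l))"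
    and eq: "comb ?b (Suc l) f = comb ?b (Suc l) g"
  have b': "?b \<in> {..<Suc l} \<rightarrow> carrier V" using b y by (auto simp: less_Suc_eq)
  let ?r = "\<lambda>f. restrict f {..<l}"
  have r: "?r f \<in> carrier (bits l)" "?r g \<in> carrier (bits l)"
    using f g unfolding carrier_bits by (auto simp: PiE_def Pi_def)
  have val: "f l = 0 \<or> f l = 1" "g l = 0 \<or> g l = 1"
    using f g unfolding carrier_bits by (auto simp: PiE_def Pi_def)
  have step: "comb ?b (Suc l) h = (if h l = 1 then y else \<one>) \<otimes> comb b l (?r h)" for h
  proof -
    have "comb ?b l h = comb b l (?r h)" by (rule comb_cong) (use b in auto)
    then show ?thesis using comb_Suc[OF b'] by simp
  qed
  have c: "comb b l (?r h) \<in> carrier V" for h using b by simp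
  have fgl: "f l = g l"
  proof (rule ccontr)
    assume ne: "f l \<noteq> g l"
    have "comb b l (?r f) \<otimes> comb b l (?r g) = y"
    proof -
      have "y \<otimes> comb b l (?r f) = comb b l (?r g) \<or> comb b l (?r f) = y \<otimes> comb b l (?r g)"
        using eq ne val c y unfolding step by auto
      then show ?thesis using c y by (metis cancel2 cancel2' m_comm)
    qed
    then have "y = comb b l (?r f \<otimes>\<^bsub>bits l\<^esub> ?r g)"
      using hom_mult[OF comb_hom[OF b] r] by simp
    moreover have "?r f \<otimes>\<^bsub>bits l\<^esub> ?r g \<in> carrier (bits l)"
      using r by (intro monoid.m_closed group.is_monoid product_group) auto
    ultimately show False using y by blast
  qed
  then have "comb b l (?r f) = comb b l (?r g)"
    using eq c y unfolding step by (auto split: if_splits)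
  then have "?r f = ?r g" using inj_onD[OF inj _ r] by blast
  then have "f i = g i" if "i < Suc l" for i
    using fgl that by (metis less_antisym lessThan_iff restrict_apply')
  then show "f = g" using f g unfolding carrier_bits by (auto intro: PiE_ext)
qed

theorem basis_exists:
  obtains l b where "b \<in> {..<l} \<rightarrow> carrier V" "comb b l \<in> iso (bits l) V"
proof -
  have "(\<exists>l b. b \<in> {..<l} \<rightarrow> carrier V \<and> bij_betw (comb b l) (carrier (bits l)) (carrier V)) \<or>
      (\<exists>b. b \<in> {..<k} \<rightarrow> carrier V \<and> inj_on (comb b k) (carrier (bits k)))" (is "?B \<or> ?I k") for k
  proof (induction k)
    case 0
    have "?I 0" by (simp add: carrier_bits)
    then show ?case ..
  next
    case (Suc k)
    show ?case
    proof (cases ?B)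
      case False
      with Suc obtain b where b: "b \<in> {..<k} \<rightarrow> carrier V"
        and inj: "inj_on (comb b k) (carrier (bits k))" by blast
      have "comb b k ` carrier (bits k) \<subseteq> carrier V" using b by auto
      moreover have "comb b k ` carrier (bits k) \<noteq> carrier V"
        using False b inj by (auto simp: bij_betw_def)
      ultimately obtain y where y: "y \<in> carrier V" "y \<notin> comb b k ` carrier (bits k)" by blast
      have "b(k := y) \<in> {..<Suc k} \<rightarrow> carrier V" using b y by (auto simp: less_Suc_eq)
      with inj_comb_Suc[OF b inj y] have "?I (Suc k)" by blast
      then show ?thesis ..
    qed blast
  qed
  moreover have "\<not> ?I (card (carrier V))"
  proof
    assume "?I (card (carrier V))"
    then obtain b where b: "b \<in> {..<card (carrier V)} \<rightarrow> carrier V"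
      and inj: "inj_on (comb b (card (carrier V))) (carrier (bits (card (carrier V))))" by blast
    have "comb b (card (carrier V)) ` carrier (bits (card (carrier V))) \<subseteq> carrier V"
      using b by auto
    from card_inj_on_le[OF inj this fin]
    have "2 ^ card (carrier V) \<le> card (carrier V)" by (simp only: card_bits)
    then show False using less_exp[of "card (carrier V)"] by simp
  qed
  ultimately obtain l b where b: "b \<in> {..<l} \<rightarrow> carrier V"
    and bij: "bij_betw (comb b l) (carrier (bits l)) (carrier V)" by blast
  show thesis by (rule that[OF b]) (use comb_hom[OF b] bij in \<open>simp add: iso_def\<close>)
qed

lemma additive_one:
  assumes "additive L" "L \<in> carrier V \<rightarrow> carrier V"
  shows "L \<one> = \<one>"
proof -
  have "L (\<one> \<otimes> \<one>) = L \<one> \<otimes> L \<one>" using assms(1) unfolding additive_def by blast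
  then show ?thesis using assms(2) sq by (metis Pi_mem one_closed r_one)
qed

lemma additive_comb:
  assumes "additive L" "L \<in> carrier V \<rightarrow> carrier V" "b \<in> {..<l} \<rightarrow> carrier V"
  shows "L (comb b l f) = comb (L \<circ> b) l f"
  using assms(3)
proof (induction l)
  case 0
  then show ?case using additive_one[OF assms(1,2)] by (simp add: comb_def)
next
  case (Suc l)
  have b: "b \<in> {..<l} \<rightarrow> carrier V" "b l \<in> carrier V" using Suc.prems by auto
  have Lb: "L \<circ> b \<in> {..<Suc l} \<rightarrow> carrier V"
    using Suc.prems assms(2) by (auto simp: Pi_iff)
  have add: "L (x \<otimes> y) = L x \<otimes> L y" if "x \<in> carrier V" "y \<in> carrier V" for x y
    using assms(1) that by (auto simp: additive_def)
  show ?case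
    using Suc.IH[OF b(1)] b additive_one[OF assms(1,2)]
    by (simp add: comb_Suc[OF Suc.prems] comb_Suc[OF Lb] add del: o_apply) (simp add: o_apply)
qed

text \<open>
  An additive map is determined by its values on a basis.
\<close>
lemma card_additive_le:
  assumes "card (carrier V) = 2 ^ d"
  shows "card {L. L permutes carrier V \<and> additive L} \<le> 2 ^ (d * d)"
proof -
  obtain l b where b: "b \<in> {..<l} \<rightarrow> carrier V" and iso: "comb b l \<in> iso (bits l) V"
    by (rule basis_exists)
  have bij: "bij_betw (comb b l) (carrier (bits l)) (carrier V)" using iso by (simp add: iso_def)
  have "(2::nat) ^ d = 2 ^ l" using bij_betw_same_card[OF bij] card_bits assms by simp
  then have l: "l = d" by simp
  let ?A = "{L. L permutes carrier V \<and> additive L}"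
  let ?r = "\<lambda>L. \<lambda>i\<in>{..<l}. L (b i)"
  have cl: "L \<in> carrier V \<rightarrow> carrier V" if "L \<in> ?A" for L
    using that by (simp add: permutes_in_image)
  have "inj_on ?r ?A"
  proof (rule inj_onI)
    fix L K assume L: "L \<in> ?A" and K: "K \<in> ?A" and eq: "?r L = ?r K"
    have Lb: "L (b i) = K (b i)" if "i < l" for i
      using fun_cong[OF eq, of i] that by simp
    have "L x = K x" if x: "x \<in> carrier V" for x
    proof -
      obtain f where f: "x = comb b l f" using x bij by (auto simp: bij_betw_def)
      have "comb (L \<circ> b) l f = comb (K \<circ> b) l f"
        by (rule comb_cong) (use Lb b cl[OF K] in auto)
      then show ?thesis using L K cl b f by (simp add: additive_comb)
    qed
    then show "L = K" using L K permutes_not_in by (metis ext mem_Collect_eq)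
  qed
  moreover have "?r ` ?A \<subseteq> {..<l} \<rightarrow>\<^sub>E carrier V"
    using cl b by (auto simp: PiE_def Pi_def)
  moreover have "finite ({..<l} \<rightarrow>\<^sub>E carrier V)" using fin by (intro finite_PiE) auto
  ultimately have "card ?A \<le> card ({..<l} \<rightarrow>\<^sub>E carrier V)" by (rule card_inj_on_le)
  also have "\<dots> = 2 ^ (d * d)" using l assms by (simp add: card_PiE power_mult)
  finally show ?thesis .
qed

end

section \<open>Adjacency in coordinates, and the group \<open>B\<close>\<close>

text \<open>
  The product of \<open>Q8\<close> modulo \<open>{1, -1}\<close>, a Klein four-group with \<open>U1\<close> as its unit.
\<close>
definition klein :: "quat_unit \<Rightarrow> quat_unit \<Rightarrow> quat_unit" where
  "klein u v = snd (unit_mult u v)"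

lemma klein_self [simp]: "klein u u = U1" by (cases u) (auto simp: klein_def)
lemma klein_U1 [simp]: "klein U1 u = u" "klein u U1 = u" by (cases u; simp add: klein_def)+
lemma klein_comm: "klein u v = klein v u" by (cases u; cases v; simp add: klein_def)
lemma klein_cancel [simp]: "klein u (klein u v) = v" by (cases u; cases v; simp add: klein_def)
lemma klein_assoc: "klein (klein u v) w = klein u (klein v w)"
  by (cases u; cases v; cases w; simp add: klein_def)
lemma klein_eq_U1_iff [simp]: "klein u v = U1 \<longleftrightarrow> u = v" by (cases u; cases v; simp add: klein_def)

lemma finite_quat_unit [simp]: "finite (UNIV :: quat_unit set)" by (simp add: UNIV_quat_unit)

lemma carrier_Q8 [simp]: "carrier Q8 = UNIV" by (simp add: Q8_def)

lemma mult_Q8 [simp]: "x \<otimes>\<^bsub>Q8\<^esub> y = quat_mult x y" by (simp add: Q8_def)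

lemma inv_Q8: "inv\<^bsub>Q8\<^esub> (s, u) = (s \<noteq> (u \<noteq> U1), u)"
  by (rule group.inv_equality[OF group_Q8]) (cases u; auto simp: Q8_def)+

locale quat_times_elem2 = elem2 E for E :: "('a, 'b) monoid_scheme" (structure)
begin

abbreviation R where "R \<equiv> Q8 \<times>\<times> E"

abbreviation C :: "(quat \<times> 'a) set" where "C \<equiv> UNIV \<times> carrier E"

text \<open>
  The centre \<open>{1, -1} \<times> E\<close> of \<open>R\<close>; it serves as a common coordinate
  system for all four of its cosets.
\<close>
definition sgnE :: "(bool \<times> 'a) monoid" where
  "sgnE = \<lparr>carrier = UNIV \<times> carrier E,
     monoid.mult = (\<lambda>(s, e) (t, f). (s \<noteq> t, e \<otimes> f)), one = (False, \<one>)\<rparr>"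

lemma sgnE_simps [simp]:
  "carrier sgnE = UNIV \<times> carrier E" "(s, e) \<otimes>\<^bsub>sgnE\<^esub> (t, f) = (s \<noteq> t, e \<otimes> f)"
  "\<one>\<^bsub>sgnE\<^esub> = (False, \<one>)"
  by (auto simp: sgnE_def)

sublocale sgn: elem2 sgnE
proof -
  have "comm_group sgnE"
    by (rule comm_groupI) (auto simp: m_ac sq intro!: bexI)
  moreover have "finite (carrier sgnE)" using fin by simp
  moreover have "x \<otimes>\<^bsub>sgnE\<^esub> x = \<one>\<^bsub>sgnE\<^esub>" if "x \<in> carrier sgnE" for x
    using that by (auto simp: sq)
  ultimately show "elem2 sgnE" by (simp add: elem2_def elem2_axioms_def)
qed

lemma finite_C: "finite C"
  using fin by (simp add: finite_prod)

lemma group_R: "group R" by (intro DirProd_group group_Q8 is_group)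

lemma carrier_R [simp]: "carrier R = C" by simp

lemma inv_R: "e \<in> carrier E \<Longrightarrow> inv\<^bsub>R\<^esub> ((s, u), e) = ((s \<noteq> (u \<noteq> U1), u), e)"
  using inv_DirProd[OF group_Q8 is_group, of "(s, u)" e] by (simp add: inv_Q8)

lemma mult_R [simp]: "(q, e) \<otimes>\<^bsub>R\<^esub> (q', e') = (quat_mult q q', e \<otimes> e')"
  by simp

definition neg :: "quat \<times> 'a \<Rightarrow> quat \<times> 'a" where
  "neg x = (quat_neg (fst x), snd x)"

lemma neg_simp [simp]: "neg ((s, u), e) = ((\<not> s, u), e)"
  by (simp add: neg_def quat_neg_def)

lemma inverse_closed_iff:
  "inverse_closed R S \<longleftrightarrow> S \<subseteq> C \<and>
     (\<forall>u e. u \<noteq> U1 \<longrightarrow> ((True, u), e) \<in> S \<longleftrightarrow> ((False, u), e) \<in> S)"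
proof -
  have "(\<lambda>x. inv\<^bsub>R\<^esub> x) ` S = S \<longleftrightarrow>
      (\<forall>u e. u \<noteq> U1 \<longrightarrow> ((True, u), e) \<in> S \<longleftrightarrow> ((False, u), e) \<in> S)"
    (is "?L \<longleftrightarrow> ?P") if sub: "S \<subseteq> C"
  proof
    have inv: "inv\<^bsub>R\<^esub> ((s, u), e) = ((s \<noteq> (u \<noteq> U1), u), e)" if "((s, u), e) \<in> S" for s u e
      using that sub inv_R by auto
    show ?P if L: ?L
    proof -
      have "((\<not> s, u), e) \<in> S" if "((s, u), e) \<in> S" "u \<noteq> U1" for s u e
      proof -
        have "inv\<^bsub>R\<^esub> ((s, u), e) \<in> (\<lambda>x. inv\<^bsub>R\<^esub> x) ` S" using that(1) by (rule imageI)
        then show ?thesis unfolding L inv[OF that(1)] using that(2) by simp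
      qed
      from this[of True] this[of False] show ?P by auto
    qed
    show ?L if P: ?P
    proof
      have mem: "inv\<^bsub>R\<^esub> x \<in> S" if "x \<in> S" for x
      proof -
        obtain s u e where x: "x = ((s, u), e)" by (metis surj_pair)
        then show ?thesis using that inv[of s u e] P by (cases "u = U1"; cases s) auto
      qed
      then show "(\<lambda>x. inv\<^bsub>R\<^esub> x) ` S \<subseteq> S" by blast
      show "S \<subseteq> (\<lambda>x. inv\<^bsub>R\<^esub> x) ` S"
      proof
        fix x assume x: "x \<in> S"
        then have "x \<in> carrier R" using sub by auto
        from group.inv_inv[OF group_R this] have "x = inv\<^bsub>R\<^esub> (inv\<^bsub>R\<^esub> x)" ..
        then show "x \<in> (\<lambda>x. inv\<^bsub>R\<^esub> x) ` S" using mem[OF x] by (rule image_eqI)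
      qed
    qed
  qed
  then show ?thesis unfolding inverse_closed_def by auto
qed

text \<open>
  Adjacency in \<open>Cay R S\<close> for inverse-closed \<open>S\<close>: inside a coset of the centre it is decided by the central
  part of \<open>S\<close>, between cosets it does not depend on signs.
\<close>
definition adj :: "(quat \<times> 'a) set \<Rightarrow> quat \<times> 'a \<Rightarrow> quat \<times> 'a \<Rightarrow> bool" where
  "adj S = (\<lambda>((s, u), e) ((t, v), f).
     if u = v then ((s \<noteq> t, U1), e \<otimes> f) \<in> S else ((False, klein u v), e \<otimes> f) \<in> S)"

lemma adj_simp: "adj S ((s, u), e) ((t, v), f) \<longleftrightarrow>
    (if u = v then ((s \<noteq> t, U1), e \<otimes> f) \<in> S else ((False, klein u v), e \<otimes> f) \<in> S)"
  by (simp add: adj_def)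

lemma adj_sym: "x \<in> C \<Longrightarrow> y \<in> C \<Longrightarrow> adj S x y \<longleftrightarrow> adj S y x"
proof -
  assume "x \<in> C" "y \<in> C"
  moreover obtain s u e t v f where xy: "x = ((s, u), e)" "y = ((t, v), f)" by (metis surj_pair)
  ultimately have "e \<otimes> f = f \<otimes> e" by (simp add: m_comm)
  then show ?thesis unfolding xy adj_simp by (cases s; cases t) (simp_all add: klein_comm)
qed

lemma adj_iff_quotient:
  assumes "inverse_closed R S" "x \<in> C" "y \<in> C"
  shows "x \<otimes>\<^bsub>R\<^esub> inv\<^bsub>R\<^esub> y \<in> S \<longleftrightarrow> adj S x y"
proof -
  obtain s u e t v f where xy: "x = ((s, u), e)" "y = ((t, v), f)" by (metis surj_pair)
  have ef: "e \<in> carrier E" "f \<in> carrier E" using assms xy by auto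
  have sgn: "((r, w), g) \<in> S \<longleftrightarrow> ((False, w), g) \<in> S" if "w \<noteq> U1" for r w g
    using that assms(1) unfolding inverse_closed_iff by (cases r) auto
  obtain r w where p: "quat_mult (s, u) (t \<noteq> (v \<noteq> U1), v) = (r, w)" by (metis surj_pair)
  have w: "w = klein u v" using p by (auto simp: klein_def)
  have r: "r \<longleftrightarrow> s \<noteq> t" if "u = v" using p that by (cases v) auto
  have "x \<otimes>\<^bsub>R\<^esub> inv\<^bsub>R\<^esub> y = ((r, w), e \<otimes> f)"
    using p unfolding xy by (simp add: inv_R ef del: quat_mult.simps)
  then show ?thesis
    using r w sgn[of w r "e \<otimes> f"] by (auto simp: xy adj_simp)
qed

lemma edge_iff_adj:
  assumes "inverse_closed R S" "x \<in> C" "y \<in> C"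
  shows "{x, y} \<in> snd (Cay R S) \<longleftrightarrow> adj S x y"
proof -
  have "{x, y} \<in> snd (Cay R S) \<longleftrightarrow> x \<otimes>\<^bsub>R\<^esub> inv\<^bsub>R\<^esub> y \<in> S \<or> y \<otimes>\<^bsub>R\<^esub> inv\<^bsub>R\<^esub> x \<in> S"
    using assms(2,3) unfolding Cay_def snd_conv mem_Collect_eq doubleton_eq_iff carrier_R by blast
  then show ?thesis using assms adj_sym by (simp add: adj_iff_quotient)
qed

lemma Aut_iff:
  assumes "inverse_closed R S"
  shows "f \<in> Aut (Cay R S) \<longleftrightarrow> f \<in> Bij C \<and>
    (\<forall>x\<in>C. \<forall>y\<in>C. adj S (f x) (f y) \<longleftrightarrow> adj S x y)"
proof -
  have "fst (Cay R S) = C" by (simp add: Cay_def)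
  moreover have "f x \<in> C" if "f \<in> Bij C" "x \<in> C" for x
    using Bij_imp_funcset[OF that(1)] that(2) by blast
  ultimately show ?thesis
    unfolding Aut_def using assms by (auto simp: edge_iff_adj)
qed

text \<open>
  The sign change on those cosets of the centre that \<open>d\<close> selects.
\<close>
definition flip :: "(quat_unit \<Rightarrow> bool) \<Rightarrow> quat \<times> 'a \<Rightarrow> quat \<times> 'a" where
  "flip d = (\<lambda>((s, u), e)\<in>C. ((s \<noteq> d u, u), e))"

lemma flip_simp: "e \<in> carrier E \<Longrightarrow> flip d ((s, u), e) = ((s \<noteq> d u, u), e)"
  by (simp add: flip_def)

lemma flip_Bij: "flip d \<in> Bij C"
proof -
  have "bij_betw (flip d) C C"
    by (rule bij_betw_byWitness[where f' = "flip d"]) (auto simp: flip_def)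
  then show ?thesis by (simp add: Bij_def flip_def)
qed

lemma flip_compose: "compose C (flip d) (flip d') = flip (\<lambda>u. d u \<noteq> d' u)"
  by (auto simp: compose_def flip_def fun_eq_iff)

definition rmul :: "quat \<times> 'a \<Rightarrow> quat \<times> 'a \<Rightarrow> quat \<times> 'a" where
  "rmul g = (\<lambda>x\<in>C. x \<otimes>\<^bsub>R\<^esub> g)"

lemma rmul_Bij:
  assumes "g \<in> C"
  shows "rmul g \<in> Bij C"
proof -
  have inj: "inj_on (rmul g) C"
    using group.inj_on_multc[OF group_R, of g] assms unfolding carrier_R
    by (auto simp: inj_on_def rmul_def simp del: mult_R mult_DirProd)
  have "x \<otimes>\<^bsub>R\<^esub> g \<in> C" if "x \<in> C" for x
    using monoid.m_closed[OF group.is_monoid[OF group_R], of x g] assms that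
    unfolding carrier_R by blast
  then have "rmul g ` C \<subseteq> C" unfolding rmul_def image_restrict_eq by blast
  with inj have "bij_betw (rmul g) C C"
    using endo_inj_surj[OF finite_C] by (auto simp: bij_betw_def)
  then show ?thesis by (simp add: Bij_def rmul_def)
qed

lemma alpha_eq_flip: "u \<noteq> U1 \<Longrightarrow> alpha E (False, u) = flip (\<lambda>v. v = u)"
  unfolding alpha_def flip_def carrier_R by (rule restrict_ext) (auto simp: quat_neg_def)

text \<open>
  The sign changes on single cosets other than the centre are the permutations \<open>\<alpha>\<^sub>t\<close>; the sign change on
  all cosets at once is right multiplication by \<open>-1\<close>.  Together they generate all sign changes.
\<close>
lemma Bgrp_rmul_flip:
  assumes "g \<in> C"
  shows "compose C (rmul g) (flip d) \<in> Bgrp E"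
proof -
  let ?gens = "right_regular R \<union> {alpha E quat_i, alpha E quat_j, alpha E quat_k}"
  have Bgrp_eq: "Bgrp E = generate (BijGroup C) ?gens" by (simp add: Bgrp_def)
  have alpha: "alpha E quat_i = flip (\<lambda>v. v = UI)" "alpha E quat_j = flip (\<lambda>v. v = UJ)"
    "alpha E quat_k = flip (\<lambda>v. v = UK)"
    by (simp_all add: alpha_eq_flip quat_i_def quat_j_def quat_k_def)
  have rr: "right_regular R = rmul ` C" by (simp add: right_regular_def rmul_def)
  have "?gens \<subseteq> carrier (BijGroup C)"
    unfolding alpha rr using flip_Bij rmul_Bij by (auto simp: BijGroup_def)
  from group.generate_incl[OF group_BijGroup this]
  have sub: "Bgrp E \<subseteq> Bij C" by (simp add: Bgrp_eq BijGroup_def)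
  have comp: "compose C f g \<in> Bgrp E" if "f \<in> Bgrp E" "g \<in> Bgrp E" for f g
  proof -
    have "f \<otimes>\<^bsub>BijGroup C\<^esub> g = compose C f g" using that sub by (auto simp: BijGroup_def)
    then show ?thesis using generate.eng[OF that[unfolded Bgrp_eq]] unfolding Bgrp_eq by simp
  qed
  have rmul: "rmul g \<in> Bgrp E" if "g \<in> C" for g
    unfolding Bgrp_eq by (rule generate.incl) (use that rr in auto)
  have one: "flip (\<lambda>_. False) \<in> Bgrp E"
  proof -
    have "flip (\<lambda>_. False) = (\<lambda>x\<in>C. x)" unfolding flip_def by (rule restrict_ext) auto
    then show ?thesis using generate.one[of "BijGroup C" ?gens]
      unfolding Bgrp_eq by (simp add: BijGroup_def)
  qed
  have all: "flip (\<lambda>_. True) \<in> Bgrp E"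
  proof -
    have "flip (\<lambda>_. True) = rmul ((True, U1), \<one>)"
    proof (rule ext)
      fix x :: "quat \<times> 'a"
      obtain s u e where "x = ((s, u), e)" by (metis surj_pair)
      then show "flip (\<lambda>_. True) x = rmul ((True, U1), \<one>) x"
        by (cases u) (auto simp: flip_def rmul_def)
    qed
    then show ?thesis using rmul[of "((True, U1), \<one>)"] by simp
  qed
  have single: "flip (\<lambda>v. v = u) \<in> Bgrp E" if "u \<noteq> U1" for u
  proof -
    have "flip (\<lambda>v. v = u) \<in> ?gens" using that alpha by (cases u) auto
    then show ?thesis unfolding Bgrp_eq by (rule generate.incl)
  qed
  have xor: "flip (\<lambda>u. d u \<noteq> d' u) \<in> Bgrp E" if "flip d \<in> Bgrp E" "flip d' \<in> Bgrp E" for d d'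
    using comp[OF that] flip_compose by simp
  have const: "flip (\<lambda>_. b) \<in> Bgrp E" for b using one all by (cases b) auto
  have single': "flip (\<lambda>v. v = u \<and> b) \<in> Bgrp E" if "u \<noteq> U1" for u b
    using single[OF that] one by (cases b) auto
  have flip: "flip d \<in> Bgrp E" for d
  proof -
    let ?s = "\<lambda>t v. v = t \<and> (d t \<noteq> d U1)"
    have "flip (\<lambda>v. d U1 \<noteq> (?s UI v \<noteq> (?s UJ v \<noteq> ?s UK v))) \<in> Bgrp E"
      by (rule xor[OF const xor[OF single' xor[OF single' single']]]) simp_all
    moreover have "(\<lambda>v. d U1 \<noteq> (?s UI v \<noteq> (?s UJ v \<noteq> ?s UK v))) = d"
    proof
      fix v show "(d U1 \<noteq> (?s UI v \<noteq> (?s UJ v \<noteq> ?s UK v))) = d v" by (cases v) auto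
    qed
    ultimately show ?thesis by simp
  qed
  show ?thesis by (rule comp[OF rmul[OF assms] flip])
qed

end

section \<open>Generic connection sets have no further automorphisms\<close>

context quat_times_elem2 begin

definition nbr_diff :: "(quat \<times> 'a) set \<Rightarrow> quat \<times> 'a \<Rightarrow> quat \<times> 'a \<Rightarrow> (quat \<times> 'a) set" where
  "nbr_diff S x y = {w \<in> C. adj S x w \<noteq> adj S y w}"

text \<open>
  For vertices of one coset of the centre with \<open>E\<close>-coordinates \<open>f\<close> and \<open>g\<close>, the first one is joined to
  exactly one of the second one and its negative if and only if \<open>split_at S (f \<otimes> g)\<close>.
\<close>
definition split_at :: "(quat \<times> 'a) set \<Rightarrow> 'a \<Rightarrow> bool" where
  "split_at S e \<longleftrightarrow> (((False, U1), e) \<in> S) \<noteq> (((True, U1), e) \<in> S)"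

text \<open>
  The bound \<open>2 M\<close> is the size of a coset of the centre, which contains all vertices that distinguish \<open>x\<close>
  from \<open>neg x\<close> (see \<open>card_nbr_diff_neg_le\<close>).
\<close>
definition separated :: "(quat \<times> 'a) set \<Rightarrow> bool" where
  "separated S \<longleftrightarrow>
     (\<forall>x\<in>C. \<forall>y\<in>C. y \<noteq> x \<longrightarrow> y \<noteq> neg x \<longrightarrow> 2 * card (carrier E) < card (nbr_diff S x y))"

text \<open>
  Any two vertices \<open>x\<close>, \<open>y \<noteq> x, neg x\<close> in a coset of the centre have an intermediate vertex \<open>w\<close> there such that \<open>x\<close>
  distinguishes \<open>w\<close> from \<open>neg w\<close> and \<open>w\<close> distinguishes \<open>y\<close> from \<open>neg y\<close>.
\<close>
definition linked :: "(quat \<times> 'a) set \<Rightarrow> bool" where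
  "linked S \<longleftrightarrow>
     (\<forall>e\<in>carrier E. e \<noteq> \<one> \<longrightarrow> (\<exists>f\<in>carrier E. split_at S f \<and> split_at S (e \<otimes> f)))"

definition rigid :: "(quat \<times> 'a) set \<Rightarrow> bool" where
  "rigid S \<longleftrightarrow> (\<forall>L. L permutes carrier sgnE \<longrightarrow> sgn.additive L \<longrightarrow>
     (\<forall>z\<in>carrier sgnE. ((fst (L z), U1), snd (L z)) \<in> S \<longleftrightarrow> ((fst z, U1), snd z) \<in> S) \<longrightarrow> L = id)"

text \<open>
  For \<open>u = v\<close> the condition excludes periods, for \<open>u \<noteq> v\<close> it says that the sets that govern adjacency
  between cosets are not translates of each other.
\<close>
definition aperiodic :: "(quat \<times> 'a) set \<Rightarrow> bool" where
  "aperiodic S \<longleftrightarrow> (\<forall>u v. \<forall>e\<in>carrier E. u \<noteq> U1 \<longrightarrow> v \<noteq> U1 \<longrightarrow>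
     (\<forall>g\<in>carrier E. ((False, u), g) \<in> S \<longleftrightarrow> ((False, v), e \<otimes> g) \<in> S) \<longrightarrow> u = v \<and> e = \<one>)"

lemma adj_same_unit: "adj S ((s, u), e) ((t, u), f) \<longleftrightarrow> ((s \<noteq> t, U1), e \<otimes> f) \<in> S"
  by (simp add: adj_simp)

lemma adj_diff_unit: "u \<noteq> v \<Longrightarrow> adj S ((s, u), e) ((t, v), f) \<longleftrightarrow> ((False, klein u v), e \<otimes> f) \<in> S"
  by (simp add: adj_simp)

lemma card_nbr_diff_neg_le: "card (nbr_diff S x (neg x)) \<le> 2 * card (carrier E)"
proof -
  obtain s u e where x: "x = ((s, u), e)" by (metis surj_pair)
  let ?f = "\<lambda>(r, g). ((r, u), g)"
  have "nbr_diff S x (neg x) \<subseteq> ?f ` ((UNIV :: bool set) \<times> carrier E)"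
  proof
    fix w assume w: "w \<in> nbr_diff S x (neg x)"
    obtain r v g where w': "w = ((r, v), g)" by (metis surj_pair)
    have "v = u" using w unfolding w' x nbr_diff_def by (auto simp: adj_simp split: if_splits)
    then have "w = ?f (r, g)" using w' by simp
    moreover have "(r, g) \<in> UNIV \<times> carrier E" using w w' by (simp add: nbr_diff_def)
    ultimately show "w \<in> ?f ` (UNIV \<times> carrier E)" by (rule image_eqI)
  qed
  then have "card (nbr_diff S x (neg x)) \<le> card (?f ` ((UNIV :: bool set) \<times> carrier E))"
    using fin by (intro card_mono) auto
  also have "\<dots> \<le> card ((UNIV :: bool set) \<times> carrier E)" using fin by (intro card_image_le) auto
  also have "\<dots> = 2 * card (carrier E)" by (simp add: card_cartesian_product)
  finally show ?thesis .
qed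

text \<open>
  An automorphism successively preserves pairs \<open>{x, neg x}\<close>, the relation \<open>rho\<close> below, the
  cosets of the centre and, up to translations, the coordinates in each coset.
\<close>
theorem Aut_subset_Bgrp:
  assumes S: "inverse_closed R S"
    and sep: "separated S" and linked: "linked S" and rigid: "rigid S" and aper: "aperiodic S"
  shows "Aut (Cay R S) \<subseteq> Bgrp E"
proof
  fix \<phi> assume "\<phi> \<in> Aut (Cay R S)"
  then have Bij: "\<phi> \<in> Bij C"
    and pres: "\<And>x y. x \<in> C \<Longrightarrow> y \<in> C \<Longrightarrow> adj S (\<phi> x) (\<phi> y) \<longleftrightarrow> adj S x y"
    using Aut_iff[OF S] unfolding carrier_R by blast+
  have inj: "inj_on \<phi> C" and img: "\<phi> ` C = C" and ext: "\<phi> \<in> extensional C"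
    using Bij by (simp_all add: Bij_def bij_betw_def)
  have cl: "\<phi> x \<in> C" if "x \<in> C" for x using img that by blast
  have neg_C: "neg x \<in> C" if "x \<in> C" for x using that by (auto simp: neg_def)
  have neg: "\<phi> (neg x) = neg (\<phi> x)" if x: "x \<in> C" for x
  proof (rule ccontr)
    assume ne: "\<phi> (neg x) \<noteq> neg (\<phi> x)"
    have "neg x \<noteq> x" by (cases x) (auto simp: neg_def quat_neg_def)
    then have ne': "\<phi> (neg x) \<noteq> \<phi> x" using inj x neg_C[OF x] by (auto dest: inj_onD)
    have "nbr_diff S (\<phi> x) (\<phi> (neg x)) \<subseteq> \<phi> ` nbr_diff S x (neg x)"
    proof
      fix w assume w: "w \<in> nbr_diff S (\<phi> x) (\<phi> (neg x))"
      then have "w \<in> C" by (simp add: nbr_diff_def)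
      then obtain v where v: "v \<in> C" "w = \<phi> v" using img by blast
      have "adj S x v \<noteq> adj S (neg x) v"
        using w pres[OF x v(1)] pres[OF neg_C[OF x] v(1)] by (simp add: nbr_diff_def v(2))
      then show "w \<in> \<phi> ` nbr_diff S x (neg x)" using v unfolding nbr_diff_def by blast
    qed
    then have "card (nbr_diff S (\<phi> x) (\<phi> (neg x))) \<le> card (nbr_diff S x (neg x))"
      by (rule surj_card_le[rotated]) (simp add: nbr_diff_def finite_C)
    also have "\<dots> \<le> 2 * card (carrier E)" by (rule card_nbr_diff_neg_le)
    finally show False
      using sep cl[OF x] cl[OF neg_C[OF x]] ne ne' unfolding separated_def by (meson not_le)
  qed
  define unit where "unit x = snd (fst x)" for x :: "quat \<times> 'a"
  define rho where "rho x y \<longleftrightarrow> adj S x y \<noteq> adj S x (neg y)" for x y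
  have rho_pres: "rho (\<phi> x) (\<phi> y) \<longleftrightarrow> rho x y" if "x \<in> C" "y \<in> C" for x y
    using pres[OF that] pres[OF that(1) neg_C[OF that(2)]] neg[OF that(2)] by (simp add: rho_def)
  have rho_unit: "unit x = unit y" if "rho x y" for x y
  proof -
    obtain s u e t v f where "x = ((s, u), e)" "y = ((t, v), f)" by (metis surj_pair)
    then show ?thesis using that by (auto simp: rho_def unit_def adj_simp split: if_splits)
  qed
  have rho_iff: "rho ((s, u), e) ((t, u), f) \<longleftrightarrow> split_at S (e \<otimes> f)" for s t u e f
    by (cases s; cases t) (auto simp: rho_def adj_same_unit split_at_def)
  have unit_neg: "unit (neg x) = unit x" for x by (simp add: unit_def neg_def quat_neg_def)
  have unit_eq: "unit (\<phi> x) = unit (\<phi> y)" if x: "x \<in> C" and y: "y \<in> C" and u: "unit x = unit y" for x y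
  proof -
    obtain s v e t f where xy: "x = ((s, v), e)" "y = ((t, v), f)"
      using u unfolding unit_def by (metis prod.collapse)
    have ef: "e \<in> carrier E" "f \<in> carrier E" using x y xy by auto
    show ?thesis
    proof (cases "e = f")
      case True
      then have "y = x \<or> y = neg x" using xy by (cases s; cases t) auto
      then show ?thesis using neg[OF x] by (metis unit_neg)
    next
      case False
      then have "e \<otimes> f \<noteq> \<one>" using ef mult_eq_one_iff by blast
      then obtain g where g: "g \<in> carrier E" "split_at S g" "split_at S ((e \<otimes> f) \<otimes> g)"
        using linked ef unfolding linked_def by blast
      let ?w = "((False, v), e \<otimes> g)"
      have w: "?w \<in> C" using ef g by simp
      have "(e \<otimes> g) \<otimes> f = (e \<otimes> f) \<otimes> g" using ef g by (simp add: m_ac)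
      then have "rho x ?w" "rho ?w y" using ef g by (simp_all add: xy rho_iff)
      then have "rho (\<phi> x) (\<phi> ?w)" "rho (\<phi> ?w) (\<phi> y)" using rho_pres x y w by auto
      then show ?thesis using rho_unit by metis
    qed
  qed
  define \<pi> where "\<pi> u = unit (\<phi> ((False, u), \<one>))" for u
  have unit_phi: "unit (\<phi> ((s, u), e)) = \<pi> u" if "e \<in> carrier E" for s u e
    unfolding \<pi>_def by (rule unit_eq) (use that in \<open>auto simp: unit_def\<close>)
  \<comment> \<open>\<open>\<pi>\<close> is the permutation of the four cosets that \<open>\<phi>\<close> induces.\<close>
  have "surj \<pi>"
    unfolding surj_def
  proof
    fix v
    have "((False, v), \<one>) \<in> \<phi> ` C" unfolding img by simp
    then obtain y where y: "y \<in> C" "\<phi> y = ((False, v), \<one>)" by auto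
    obtain s u e where "y = ((s, u), e)" by (metis surj_pair)
    then have "v = \<pi> u" using y unit_phi[of e s u] by (simp add: unit_def)
    then show "\<exists>u. v = \<pi> u" ..
  qed
  then have inj_pi: "inj \<pi>" by (rule finite_UNIV_surj_inj[OF finite_quat_unit])
  \<comment> \<open>the action of \<open>\<phi>\<close> on one coset, in the coordinates of the central subgroup\<close>
  define pr where "pr x = (fst (fst x), snd x)" for x :: "quat \<times> 'a"
  define g where "g u z = (if z \<in> carrier sgnE then pr (\<phi> ((fst z, u), snd z)) else z)" for u z
  define Z where "Z = carrier sgnE"
  have Z_iff: "(s, e) \<in> Z \<longleftrightarrow> e \<in> carrier E" for s e by (simp add: Z_def)
  have phi_eq: "\<phi> ((s, u), e) = ((fst (g u (s, e)), \<pi> u), snd (g u (s, e)))" if "e \<in> carrier E" for s u e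
  proof -
    obtain t v f where p: "\<phi> ((s, u), e) = ((t, v), f)" by (metis surj_pair)
    then show ?thesis using unit_phi[OF that, of s u] that by (simp add: g_def pr_def unit_def)
  qed
  have g_Z: "g u z \<in> Z" if "z \<in> Z" for u z
  proof -
    obtain s e where z: "z = (s, e)" by fastforce
    have "\<phi> ((s, u), e) \<in> C" using cl that by (simp add: z Z_iff)
    then show ?thesis using that by (auto simp: z g_def pr_def Z_def)
  qed
  have g_perm: "g u permutes Z" for u
  proof (rule bij_imp_permutes)
    have "inj_on (g u) Z"
    proof (rule inj_onI)
      fix z z' assume z: "z \<in> Z" "z' \<in> Z" and eq: "g u z = g u z'"
      obtain s e s' e' where zz: "z = (s, e)" "z' = (s', e')" by fastforce
      have "\<phi> ((s, u), e) = \<phi> ((s', u), e')" using z eq phi_eq by (simp add: zz Z_iff)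
      moreover have "((s, u), e) \<in> C" "((s', u), e') \<in> C" using z by (simp_all add: zz Z_iff)
      ultimately have "((s, u), e) = ((s', u), e')" using inj by (metis inj_onD)
      then show "z = z'" using zz by simp
    qed
    moreover have "g u ` Z \<subseteq> Z" using g_Z by blast
    moreover have "finite Z" using fin by (simp add: Z_def)
    ultimately show "bij_betw (g u) Z Z" using endo_inj_surj by (metis bij_betw_def)
    show "g u z = z" if "z \<notin> Z" for z using that by (simp add: g_def Z_def)
  qed
  define mem where "mem z \<longleftrightarrow> ((fst z, U1), snd z) \<in> S" for z :: "bool \<times> 'a"
  define A where
    "A = {h. h permutes Z \<and> (\<forall>z\<in>Z. \<forall>z'\<in>Z. mem (h z \<otimes>\<^bsub>sgnE\<^esub> h z') \<longleftrightarrow> mem (z \<otimes>\<^bsub>sgnE\<^esub> z'))}"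
  have g_A: "g u \<in> A" for u
  proof -
    have "mem (g u z \<otimes>\<^bsub>sgnE\<^esub> g u z') \<longleftrightarrow> mem (z \<otimes>\<^bsub>sgnE\<^esub> z')" if z: "z \<in> Z" "z' \<in> Z" for z z'
    proof -
      obtain s e s' e' where zz: "z = (s, e)" "z' = (s', e')" by fastforce
      have e: "e \<in> carrier E" "e' \<in> carrier E" using z by (simp_all add: zz Z_iff)
      obtain t f t' f' where gz: "g u z = (t, f)" "g u z' = (t', f')" by fastforce
      have "adj S ((t, \<pi> u), f) ((t', \<pi> u), f') \<longleftrightarrow> adj S ((s, u), e) ((s', u), e')"
        using pres[of "((s, u), e)" "((s', u), e')"] e phi_eq gz zz by simp
      then show ?thesis unfolding adj_same_unit gz unfolding zz by (simp add: mem_def)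
    qed
    then show ?thesis using g_perm by (simp add: A_def)
  qed
  have g_translation: "g u = sgn.translation (g u (False, \<one>))" for u
  proof -
    have "g u = sgn.translation (g u \<one>\<^bsub>sgnE\<^esub>)"
    proof (rule sgn.regular_if_no_additive[where A = A])
      show "h permutes carrier sgnE" if "h \<in> A" for h using that by (simp add: A_def Z_def)
      show "h \<circ> k \<in> A" if "h \<in> A" "k \<in> A" for h k
        using that by (auto simp: A_def permutes_compose permutes_in_image)
      show "sgn.translation z \<in> A" if "z \<in> carrier sgnE" for z
      proof -
        have "sgn.translation z x \<otimes>\<^bsub>sgnE\<^esub> sgn.translation z y = x \<otimes>\<^bsub>sgnE\<^esub> y" if "x \<in> Z" "y \<in> Z" for x y
        proof -
          have "(z \<otimes>\<^bsub>sgnE\<^esub> x) \<otimes>\<^bsub>sgnE\<^esub> (z \<otimes>\<^bsub>sgnE\<^esub> y) = x \<otimes>\<^bsub>sgnE\<^esub> y"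
            using that \<open>z \<in> carrier sgnE\<close> unfolding Z_def
            by (metis sgn.cancel2 sgn.m_assoc sgn.m_closed sgn.m_comm)
          then show ?thesis using that by (simp add: sgn.translation_def Z_def del: sgnE_simps)
        qed
        then show ?thesis using sgn.translation_permutes[OF that] by (simp add: A_def Z_def del: sgnE_simps)
      qed
      show "h = id" if h: "h \<in> A" "sgn.additive h" for h
      proof -
        have hp: "h permutes carrier sgnE" using h by (simp add: A_def Z_def)
        have hcl: "h z \<in> carrier sgnE" if "z \<in> carrier sgnE" for z
          using permutes_in_image[OF hp] that by blast
        have h1: "h \<one>\<^bsub>sgnE\<^esub> = \<one>\<^bsub>sgnE\<^esub>" using sgn.additive_one[OF h(2)] hcl by blast
        have "mem (h z) \<longleftrightarrow> mem z" if z: "z \<in> carrier sgnE" for z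
        proof -
          have "mem (h z \<otimes>\<^bsub>sgnE\<^esub> h \<one>\<^bsub>sgnE\<^esub>) \<longleftrightarrow> mem (z \<otimes>\<^bsub>sgnE\<^esub> \<one>\<^bsub>sgnE\<^esub>)"
            using h(1) z sgn.one_closed unfolding A_def Z_def by blast
          then show ?thesis
            unfolding h1 sgn.r_one[OF z] sgn.r_one[OF hcl[OF z]] .
        qed
        then have "((fst (h z), U1), snd (h z)) \<in> S \<longleftrightarrow> ((fst z, U1), snd z) \<in> S"
          if "z \<in> carrier sgnE" for z
          using that unfolding mem_def by blast
        with rigid hp h(2) show ?thesis unfolding rigid_def by blast
      qed
      show "g u \<in> A" by (rule g_A)
    qed
    then show ?thesis by simp
  qed
  \<comment> \<open>Thus \<open>\<phi>\<close> translates the coset \<open>u\<close> by \<open>c u = (\<sigma> u, a u)\<close>; it remains to compare the four translations.\<close>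
  define c where "c u = g u (False, \<one>)" for u
  define \<sigma> where "\<sigma> u = fst (c u)" for u
  define a where "a u = snd (c u)" for u
  have aE: "a u \<in> carrier E" for u
    using g_Z[of "(False, \<one>)" u] by (cases "c u") (simp add: a_def c_def Z_iff)
  have phi: "\<phi> ((s, u), e) = ((\<sigma> u \<noteq> s, \<pi> u), a u \<otimes> e)" if "e \<in> carrier E" for s u e
  proof -
    have "g u (s, e) = sgn.translation (c u) (s, e)" using g_translation[of u] unfolding c_def by metis
    also have "\<dots> = (\<sigma> u, a u) \<otimes>\<^bsub>sgnE\<^esub> (s, e)" using that by (simp add: sgn.translation_def \<sigma>_def a_def)
    finally have "g u (s, e) = (\<sigma> u \<noteq> s, a u \<otimes> e)" by simp
    then show ?thesis using phi_eq[OF that] by simp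
  qed
  \<comment> \<open>Adjacency between two cosets, before and after \<open>\<phi>\<close>, compares two of the sets in \<open>aperiodic\<close>.\<close>
  have shift: "klein u v = klein (\<pi> u) (\<pi> v) \<and> a u \<otimes> a v = \<one>" if uv: "u \<noteq> v" for u v
  proof -
    have pi: "\<pi> u \<noteq> \<pi> v" using inj_pi uv by (auto dest: injD)
    have "((False, klein u v), h) \<in> S \<longleftrightarrow> ((False, klein (\<pi> u) (\<pi> v)), (a u \<otimes> a v) \<otimes> h) \<in> S"
      if h: "h \<in> carrier E" for h
    proof -
      have "adj S (\<phi> ((False, u), h)) (\<phi> ((False, v), \<one>)) \<longleftrightarrow> adj S ((False, u), h) ((False, v), \<one>)"
        by (rule pres) (use h in auto)
      moreover have "(a u \<otimes> h) \<otimes> a v = (a u \<otimes> a v) \<otimes> h" using h aE by (simp add: m_ac)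
      ultimately show ?thesis using h aE by (simp add: phi adj_diff_unit uv pi)
    qed
    moreover have "klein u v \<noteq> U1" "klein (\<pi> u) (\<pi> v) \<noteq> U1" using uv pi by simp_all
    moreover have "a u \<otimes> a v \<in> carrier E" using aE by simp
    ultimately show ?thesis using aper[unfolded aperiodic_def, rule_format] by blast
  qed
  have a_eq: "a u = a U1" for u
    using shift[of u U1] aE mult_eq_one_iff by (cases "u = U1") auto
  have pi_eq: "\<pi> u = klein u (\<pi> U1)" for u
  proof (cases "u = U1")
    case False
    then have "u = klein (\<pi> U1) (\<pi> u)" using shift[of u U1] by (simp add: klein_comm)
    then show ?thesis by (metis klein_cancel klein_comm)
  qed simp
  \<comment> \<open>Right multiplication by \<open>?r\<close> introduces the sign \<open>fst (unit_mult u p)\<close> on the coset \<open>u\<close>, which \<open>?d\<close> cancels.\<close>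
  define p where "p = \<pi> U1"
  let ?r = "((False, p), a U1)"
  let ?d = "\<lambda>u. \<sigma> u \<noteq> fst (unit_mult u p)"
  have "\<phi> = compose C (rmul ?r) (flip ?d)"
  proof (rule extensionalityI[OF ext])
    show "compose C (rmul ?r) (flip ?d) \<in> extensional C" by simp
    fix x assume x: "x \<in> C"
    obtain s u e where xs: "x = ((s, u), e)" by (metis surj_pair)
    have e: "e \<in> carrier E" using x xs by simp
    have "\<phi> x = ((\<sigma> u \<noteq> s, klein u p), a U1 \<otimes> e)"
      using phi[OF e, of s u] a_eq[of u] pi_eq[of u] by (simp add: xs p_def)
    moreover have "a U1 \<otimes> e = e \<otimes> a U1" using e aE by (simp add: m_comm)
    moreover have "rmul ?r (flip ?d x) = ((((s \<noteq> ?d u) \<noteq> False) \<noteq> fst (unit_mult u p), klein u p), e \<otimes> a U1)"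
      using e aE by (simp add: xs flip_simp rmul_def klein_def)
    ultimately show "\<phi> x = compose C (rmul ?r) (flip ?d) x"
      using x by (simp add: compose_eq) blast
  qed
  then show "\<phi> \<in> Bgrp E" using Bgrp_rmul_flip[of ?r ?d] aE by simp
qed

end

section \<open>Counting sets with prescribed disagreements\<close>

text \<open>
  The graph with edges \<open>{x, L x}\<close> has maximum degree 2, so a maximal independent set contains at least a third
  of the vertices.  Comparing the points of \<open>I\<close> with their images is then a case of \<open>card_agreement_pattern_le\<close>.
\<close>
lemma independent_subset:
  assumes fin: "finite F" and L: "L ` F \<subseteq> F" "inj_on L F" and nofix: "\<And>x. x \<in> F \<Longrightarrow> L x \<noteq> x"
  obtains I where "I \<subseteq> F" "I \<inter> L ` I = {}" "F \<subseteq> I \<union> L ` I \<union> {x \<in> F. L x \<in> I}"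
    "card F \<le> 3 * card I"
proof -
  let ?\<I> = "{I. I \<subseteq> F \<and> I \<inter> L ` I = {}}"
  have "?\<I> \<subseteq> Pow F" by blast
  then have "finite ?\<I>" using fin finite_Pow_iff finite_subset by metis
  moreover have "?\<I> \<noteq> {}" by blast
  ultimately have "\<exists>I\<in>?\<I>. \<forall>I'\<in>?\<I>. I \<subseteq> I' \<longrightarrow> I = I'" by (rule finite_has_maximal)
  then obtain I where I: "I \<subseteq> F" "I \<inter> L ` I = {}"
    and max: "\<And>I'. I' \<subseteq> F \<Longrightarrow> I' \<inter> L ` I' = {} \<Longrightarrow> I \<subseteq> I' \<Longrightarrow> I = I'" by auto
  have cover: "F \<subseteq> I \<union> L ` I \<union> {x \<in> F. L x \<in> I}"
  proof
    fix x assume x: "x \<in> F"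
    show "x \<in> I \<union> L ` I \<union> {x \<in> F. L x \<in> I}"
    proof (rule ccontr)
      assume not: "x \<notin> I \<union> L ` I \<union> {x \<in> F. L x \<in> I}"
      have "insert x I \<inter> L ` insert x I = {}" using not I x nofix[OF x] by auto
      from max[OF _ this] I x not show False by auto
    qed
  qed
  have finI: "finite I" using I fin finite_subset by auto
  have inj: "inj_on L {x \<in> F. L x \<in> I}" using L(2) by (rule inj_on_subset) auto
  have "card F \<le> card (I \<union> L ` I \<union> {x \<in> F. L x \<in> I})"
    using cover finI fin by (intro card_mono) auto
  moreover have "card (I \<union> L ` I \<union> {x \<in> F. L x \<in> I}) \<le> card (I \<union> L ` I) + card {x \<in> F. L x \<in> I}"
    by (rule card_Un_le)
  moreover have "card (I \<union> L ` I) \<le> card I + card (L ` I)" by (rule card_Un_le)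
  moreover have "card (L ` I) \<le> card I" using finI by (rule card_image_le)
  moreover have "card {x \<in> F. L x \<in> I} \<le> card I"
    by (rule card_inj_on_le[OF inj _ finI]) auto
  ultimately have "card F \<le> 3 * card I" by linarith
  then show thesis by (rule that[OF I cover])
qed

lemma involution_transversal:
  assumes fin: "finite F" and L: "L ` F \<subseteq> F" "\<And>x. x \<in> F \<Longrightarrow> L (L x) = x"
    and nofix: "\<And>x. x \<in> F \<Longrightarrow> L x \<noteq> x"
  obtains J where "J \<subseteq> F" "J \<inter> L ` J = {}" "F = J \<union> L ` J" "card F = 2 * card J"
proof -
  have inj: "inj_on L F" using L(2) by (metis inj_onI)
  obtain J where J: "J \<subseteq> F" "J \<inter> L ` J = {}" "F \<subseteq> J \<union> L ` J \<union> {x \<in> F. L x \<in> J}"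
    and "card F \<le> 3 * card J"
    by (rule independent_subset[OF fin L(1) inj nofix])
  have "{x \<in> F. L x \<in> J} \<subseteq> L ` J" using L(2) by force
  then have F: "F = J \<union> L ` J" using J L(1) by blast
  moreover have "card (L ` J) = card J" using inj J(1) by (intro card_image) (rule inj_on_subset)
  moreover have "finite J" using J(1) fin finite_subset by blast
  ultimately have "card F = 2 * card J" using J(2) card_Un_disjoint[of J "L ` J"] by simp
  with J F that show thesis by blast
qed

text \<open>
  A set \<open>W\<close> can be recovered from its part outside \<open>a ` K\<close> and the set of indices where \<open>a k\<close> and \<open>b k\<close>
  disagree: the former determines membership of every \<open>b k\<close>, and then the latter that of \<open>a k\<close>.
\<close>
lemma card_agreement_pattern_le:
  assumes fin: "finite Y" and inj: "inj_on a K" and a: "a ` K \<subseteq> Y" and b: "b ` K \<subseteq> Y - a ` K"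
    and Q: "P \<subseteq> Pow K"
  shows "card {W \<in> Pow Y. {k \<in> K. (a k \<in> W) \<noteq> (b k \<in> W)} \<in> P} \<le> 2 ^ (card Y - card K) * card P"
proof -
  let ?p = "\<lambda>W. {k \<in> K. (a k \<in> W) \<noteq> (b k \<in> W)}"
  let ?f = "\<lambda>W. (W - a ` K, ?p W)"
  have finK: "finite K" using inj a fin finite_subset finite_imageD by metis
  have finQ: "finite P" using Q finK by (meson finite_Pow_iff finite_subset)
  have "inj_on ?f {W \<in> Pow Y. ?p W \<in> P}"
  proof (rule inj_onI)
    fix W W' assume W: "W \<in> {W \<in> Pow Y. ?p W \<in> P}" "W' \<in> {W \<in> Pow Y. ?p W \<in> P}"
      and eq: "?f W = ?f W'"
    have out: "x \<in> W \<longleftrightarrow> x \<in> W'" if "x \<notin> a ` K" for x using eq that by blast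
    have "a k \<in> W \<longleftrightarrow> a k \<in> W'" if k: "k \<in> K" for k
    proof -
      have "b k \<in> W \<longleftrightarrow> b k \<in> W'" using out b k by blast
      moreover have "k \<in> ?p W \<longleftrightarrow> k \<in> ?p W'" using eq by simp
      ultimately show ?thesis using k by blast
    qed
    then have "x \<in> W \<longleftrightarrow> x \<in> W'" for x using out[of x] by (cases "x \<in> a ` K") auto
    then show "W = W'" by blast
  qed
  moreover have "?f ` {W \<in> Pow Y. ?p W \<in> P} \<subseteq> Pow (Y - a ` K) \<times> P" by auto
  moreover have "finite (Pow (Y - a ` K) \<times> P)" using fin finQ by auto
  ultimately have "card {W \<in> Pow Y. ?p W \<in> P} \<le> card (Pow (Y - a ` K) \<times> P)"
    by (rule card_inj_on_le)
  also have "\<dots> = 2 ^ (card Y - card K) * card P"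
    using fin a inj finK by (simp add: card_cartesian_product card_Pow card_Diff_subset card_image)
  finally show ?thesis .
qed

lemma sum_Pow_half: "finite K \<Longrightarrow> (\<Sum>D\<in>Pow K. (1/2 :: real) ^ card D) = (3/2) ^ card K"
proof (induction K rule: finite_induct)
  case (insert k K)
  have "(\<Sum>D\<in>Pow (insert k K). (1/2 :: real) ^ card D)
      = (\<Sum>D\<in>Pow K. (1/2) ^ card D) + (\<Sum>D\<in>insert k ` Pow K. (1/2) ^ card D)"
    unfolding Pow_insert using insert.hyps by (intro sum.union_disjoint) auto
  also have "(\<Sum>D\<in>insert k ` Pow K. (1/2 :: real) ^ card D) = (\<Sum>D\<in>Pow K. (1/2) ^ card (insert k D))"
    using insert.hyps by (intro sum.reindex_cong[where l = "insert k"]) (auto simp: inj_on_def)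
  also have "\<dots> = (\<Sum>D\<in>Pow K. (1/2) * (1/2) ^ card D)"
  proof (rule sum.cong)
    fix D assume "D \<in> Pow K"
    then have "k \<notin> D" "finite D" using insert.hyps finite_subset by auto
    then show "(1/2 :: real) ^ card (insert k D) = (1/2) * (1/2) ^ card D" by simp
  qed simp
  also have "\<dots> = (1/2) * (\<Sum>D\<in>Pow K. (1/2) ^ card D)" by (rule sum_distrib_left [symmetric])
  finally show ?case using insert by simp
qed simp

text \<open>
  A way to compare \<open>c\<close> with a power of 2 whose exponent is a multiple of one fifth, by an
  inequality between integer powers.
\<close>
lemma le_two_powr:
  assumes "c ^ 5 \<le> 2 ^ q" "0 < (c::real)"
  shows "c ^ m \<le> 2 powr (real q / 5 * real m)"
proof -
  have "c ^ 5 = c powr 5" using assms(2) by simp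
  then have "c = (c ^ 5) powr (1/5)" using assms(2) by (simp only: powr_powr) simp
  also have "\<dots> \<le> (2 ^ q) powr (1/5)" using assms by (intro powr_mono2) auto
  also have "\<dots> = 2 powr (real q / 5)" using powr_realpow[of 2 q] powr_powr[of 2 "real q" "1/5"] by simp
  finally have "c ^ m \<le> (2 powr (real q / 5)) ^ m" using assms(2) by (intro power_mono) auto
  also have "\<dots> = (2 powr (real q / 5)) powr real m" by (simp add: powr_realpow)
  also have "\<dots> = 2 powr (real q / 5 * real m)" by (rule powr_powr)
  finally show ?thesis .
qed

text \<open>
  Chernoff's bound with weight \<open>1/2\<close>: a subset with at most a third of the elements satisfies
  \<open>1 \<le> 2^(|K|/3) (1/2)^|D|\<close>, and the sum of \<open>(1/2)^|D|\<close> over all subsets is \<open>(3/2)^|K|\<close>.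
\<close>
lemma card_small_subsets_le:
  assumes "finite K"
  shows "real (card {D. D \<subseteq> K \<and> 3 * card D \<le> card K}) \<le> 2 powr (14/15 * real (card K))"
proof -
  let ?m = "card K" and ?A = "{D. D \<subseteq> K \<and> 3 * card D \<le> card K}"
  have "real (card ?A) = (\<Sum>D\<in>?A. 1)" by simp
  also have "\<dots> \<le> (\<Sum>D\<in>?A. 2 powr (real ?m / 3) * (1/2) ^ card D)"
  proof (rule sum_mono)
    fix D assume "D \<in> ?A"
    then have "real (card D) \<le> real ?m / 3" by simp
    then have "2 powr real (card D) \<le> 2 powr (real ?m / 3)" by (rule powr_mono) simp
    then have "2 ^ card D \<le> 2 powr (real ?m / 3)" by (simp add: powr_realpow)
    then show "1 \<le> 2 powr (real ?m / 3) * (1/2) ^ card D"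
      by (simp add: power_one_over field_simps)
  qed
  also have "\<dots> \<le> (\<Sum>D\<in>Pow K. 2 powr (real ?m / 3) * (1/2) ^ card D)"
    using assms by (intro sum_mono2) auto
  also have "\<dots> = 2 powr (real ?m / 3) * (3/2) ^ ?m"
    using sum_Pow_half[OF assms] by (simp add: sum_distrib_left [symmetric])
  also have "\<dots> \<le> 2 powr (real ?m / 3) * 2 powr (real 3 / 5 * real ?m)"
    by (intro mult_left_mono le_two_powr) (auto simp: power_divide)
  also have "\<dots> = 2 powr (14/15 * real ?m)"
    by (simp add: powr_add [symmetric] field_simps)
  finally show ?thesis .
qed

lemma card_few_disagreements_le:
  assumes fin: "finite Y" and inj: "inj_on a K" and a: "a ` K \<subseteq> Y" and b: "b ` K \<subseteq> Y - a ` K"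
  shows "real (card {W \<in> Pow Y. 3 * card {k \<in> K. (a k \<in> W) \<noteq> (b k \<in> W)} \<le> card K})
    \<le> 2 powr (real (card Y) - real (card K) / 15)"
proof -
  let ?Q = "{D. D \<subseteq> K \<and> 3 * card D \<le> card K}"
  have finK: "finite K" using inj a fin finite_subset finite_imageD by metis
  have le: "card K \<le> card Y" using card_inj_on_le[OF inj a fin] .
  have "{W \<in> Pow Y. 3 * card {k \<in> K. (a k \<in> W) \<noteq> (b k \<in> W)} \<le> card K}
      = {W \<in> Pow Y. {k \<in> K. (a k \<in> W) \<noteq> (b k \<in> W)} \<in> ?Q}" by auto
  then have "card {W \<in> Pow Y. 3 * card {k \<in> K. (a k \<in> W) \<noteq> (b k \<in> W)} \<le> card K}
      \<le> 2 ^ (card Y - card K) * card ?Q"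
    using card_agreement_pattern_le[OF fin inj a b, of ?Q] by auto
  then have "real (card {W \<in> Pow Y. 3 * card {k \<in> K. (a k \<in> W) \<noteq> (b k \<in> W)} \<le> card K})
      \<le> real (2 ^ (card Y - card K) * card ?Q)" by (rule of_nat_mono)
  also have "\<dots> = 2 powr (real (card Y) - real (card K)) * real (card ?Q)"
    using le powr_realpow[of 2 "card Y - card K"] by (simp add: of_nat_diff)
  also have "\<dots> \<le> 2 powr (real (card Y) - real (card K)) * 2 powr (14/15 * real (card K))"
    by (intro mult_left_mono card_small_subsets_le finK) auto
  also have "\<dots> = 2 powr (real (card Y) - real (card K) / 15)"
    by (simp add: powr_add [symmetric] field_simps)
  finally show ?thesis .
qed

text \<open>
  On each orbit of the involution, three of the four subsets are possible; \<open>3^5 \<le> 2^8\<close> gives the exponent.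
\<close>
lemma card_involution_avoiding_le:
  assumes fin: "finite F" and L: "L ` F \<subseteq> F" "\<And>x. x \<in> F \<Longrightarrow> L (L x) = x"
    and nofix: "\<And>x. x \<in> F \<Longrightarrow> L x \<noteq> x"
  shows "real (card {D. D \<subseteq> F \<and> (\<forall>x\<in>F. \<not> (x \<in> D \<and> L x \<in> D))}) \<le> 2 powr (4/5 * real (card F))"
proof -
  let ?D = "{D. D \<subseteq> F \<and> (\<forall>x\<in>F. \<not> (x \<in> D \<and> L x \<in> D))}"
  let ?P = "{(True, False), (False, True), (False, False)}"
  obtain J where J: "J \<subseteq> F" "F = J \<union> L ` J" "card F = 2 * card J"
    and "J \<inter> L ` J = {}"
    by (rule involution_transversal[OF fin L nofix])
  have finJ: "finite J" using J(1) fin finite_subset by blast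
  let ?f = "\<lambda>D. \<lambda>j\<in>J. (j \<in> D, L j \<in> D)"
  have "inj_on ?f ?D"
  proof (rule inj_onI)
    fix D D' assume D: "D \<in> ?D" "D' \<in> ?D" and eq: "?f D = ?f D'"
    have "(j \<in> D \<longleftrightarrow> j \<in> D') \<and> (L j \<in> D \<longleftrightarrow> L j \<in> D')" if "j \<in> J" for j
      using fun_cong[OF eq, of j] that by simp
    then have "x \<in> D \<longleftrightarrow> x \<in> D'" if "x \<in> F" for x using that unfolding J(2) by blast
    then show "D = D'" using D by blast
  qed
  moreover have "?f ` ?D \<subseteq> J \<rightarrow>\<^sub>E ?P" using J(1) by auto
  moreover have "finite (J \<rightarrow>\<^sub>E ?P)" using finJ by (intro finite_PiE) auto
  ultimately have "card ?D \<le> card (J \<rightarrow>\<^sub>E ?P)" by (rule card_inj_on_le)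
  also have "\<dots> = 3 ^ card J" using finJ by (simp add: card_PiE numeral_3_eq_3)
  finally have "real (card ?D) \<le> real (3 ^ card J)" by (rule of_nat_mono)
  then have "real (card ?D) \<le> 3 ^ card J" by simp
  also have "\<dots> \<le> 2 powr (real 8 / 5 * real (card J))" by (rule le_two_powr) auto
  also have "\<dots> = 2 powr (4/5 * real (card F))" using J(3) by simp
  finally show ?thesis .
qed

section \<open>Exceptional connection sets are rare\<close>

context quat_times_elem2 begin

text \<open>
  One element of each pair \<open>{x, inv x}\<close>; membership of these elements can be chosen freely.
\<close>
definition reps :: "(quat \<times> 'a) set" where
  "reps = {(False, U1), (True, U1), (False, UI), (False, UJ), (False, UK)} \<times> carrier E"

abbreviation M where "M \<equiv> card (carrier E)"

lemma reps_iff: "((s, u), e) \<in> reps \<longleftrightarrow> e \<in> carrier E \<and> (u = U1 \<or> \<not> s)"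
  unfolding reps_def by (cases u) auto

lemma finite_reps: "finite reps" unfolding reps_def using fin by simp

lemma card_reps: "card reps = 5 * M" unfolding reps_def by (simp add: card_cartesian_product)

lemma bij_betw_inverse_closed: "bij_betw (\<lambda>S. S \<inter> reps) {S. inverse_closed R S} (Pow reps)"
proof -
  define ext where "ext W = {((s, u), e) | s u e. ((s \<and> u = U1, u), e) \<in> W}" for W :: "(quat \<times> 'a) set"
  have ext_iff: "((s, u), e) \<in> ext W \<longleftrightarrow> ((s \<and> u = U1, u), e) \<in> W" for s u e W
    by (simp add: ext_def)
  have eqI: "A = B" if "\<And>s u e. ((s, u), e) \<in> A \<longleftrightarrow> ((s, u), e) \<in> B" for A B :: "(quat \<times> 'a) set"
    using that by (metis subset_antisym subsetI surj_pair)
  have ext_Int: "ext (S \<inter> reps) = S" if S: "inverse_closed R S" for S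
  proof (rule eqI)
    fix s u e
    have "((s, u), e) \<in> S \<Longrightarrow> e \<in> carrier E" for s u e
      using S unfolding inverse_closed_iff by auto
    moreover have "((s \<and> u = U1, u), e) \<in> S \<longleftrightarrow> ((s, u), e) \<in> S"
      using S unfolding inverse_closed_iff by (cases s; cases "u = U1") auto
    ultimately show "((s, u), e) \<in> ext (S \<inter> reps) \<longleftrightarrow> ((s, u), e) \<in> S"
      unfolding ext_iff by (auto simp: reps_iff)
  qed
  have Int_ext: "ext W \<inter> reps = W" if W: "W \<subseteq> reps" for W
  proof (rule eqI)
    fix s u e
    have "((s, u), e) \<in> W \<Longrightarrow> ((s, u), e) \<in> reps" using W by blast
    then show "((s, u), e) \<in> ext W \<inter> reps \<longleftrightarrow> ((s, u), e) \<in> W"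
      unfolding Int_iff ext_iff reps_iff by (cases s; cases "u = U1") auto
  qed
  have ext_closed: "inverse_closed R (ext W)" if W: "W \<subseteq> reps" for W
  proof -
    have "e \<in> carrier E" if "((s, u), e) \<in> ext W" for s u e
      using that W unfolding ext_iff by (metis reps_iff subsetD)
    then show ?thesis unfolding inverse_closed_iff by (auto simp: ext_iff)
  qed
  show ?thesis
    by (rule bij_betw_byWitness[where f' = ext]) (use ext_Int Int_ext ext_closed in auto)
qed

lemma finite_inverse_closed: "finite {S. inverse_closed R S}"
  using bij_betw_finite[OF bij_betw_inverse_closed] finite_reps by simp

lemma card_inverse_closed: "card {S. inverse_closed R S} = 2 ^ (5 * M)"
  using bij_betw_same_card[OF bij_betw_inverse_closed] by (simp add: card_Pow finite_reps card_reps)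

lemma card_inverse_closed_via_reps:
  assumes "\<And>S. inverse_closed R S \<Longrightarrow> P S \<longleftrightarrow> P (S \<inter> reps)"
  shows "card {S. inverse_closed R S \<and> P S} = card {W \<in> Pow reps. P W}"
proof (rule bij_betw_same_card)
  let ?f = "\<lambda>S. S \<inter> reps"
  have inj: "inj_on ?f {S. inverse_closed R S \<and> P S}"
    using bij_betw_imp_inj_on[OF bij_betw_inverse_closed] by (rule inj_on_subset) blast
  have surj: "\<exists>S. inverse_closed R S \<and> W = S \<inter> reps" if "W \<subseteq> reps" for W
  proof -
    have "W \<in> ?f ` {S. inverse_closed R S}"
      using that bij_betw_imp_surj_on[OF bij_betw_inverse_closed] by blast
    then show ?thesis by blast
  qed
  have "?f ` {S. inverse_closed R S \<and> P S} = {W \<in> Pow reps. P W}"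
  proof (intro subset_antisym subsetI)
    fix W assume "W \<in> ?f ` {S. inverse_closed R S \<and> P S}"
    then show "W \<in> {W \<in> Pow reps. P W}" using assms by auto
  next
    fix W assume "W \<in> {W \<in> Pow reps. P W}"
    then have W: "W \<subseteq> reps" "P W" by auto
    from surj[OF W(1)] obtain S where S: "inverse_closed R S" "W = S \<inter> reps" by blast
    then have "P S" using assms[OF S(1)] W(2) by simp
    then show "W \<in> ?f ` {S. inverse_closed R S \<and> P S}" using S by blast
  qed
  with inj show "bij_betw ?f {S. inverse_closed R S \<and> P S} {W \<in> Pow reps. P W}"
    by (simp add: bij_betw_def)
qed

text \<open>
  Since \<open>M / 64 = n / 512\<close>, this is a single term of the final union bound.
\<close>
definition rare :: "((quat \<times> 'a) set \<Rightarrow> bool) \<Rightarrow> bool" where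
  "rare P \<longleftrightarrow> real (card {S. inverse_closed R S \<and> P S}) \<le> 2 powr (5 * real M - real M / 64)"

lemma rare_mono:
  assumes "rare Q" "\<And>S. inverse_closed R S \<Longrightarrow> P S \<Longrightarrow> Q S"
  shows "rare P"
proof -
  have "card {S. inverse_closed R S \<and> P S} \<le> card {S. inverse_closed R S \<and> Q S}"
    by (rule card_mono) (use finite_inverse_closed assms(2) in auto)
  then show ?thesis using assms(1) unfolding rare_def by linarith
qed

text \<open>
  At most a third of the disagreements, on \<open>M / 3\<close> or more pairs of choices, costs a factor of
  \<open>2^(M/45)\<close>.
\<close>
lemma rare_few_disagreements:
  assumes inj: "inj_on a K" and a: "a ` K \<subseteq> reps" and b: "b ` K \<subseteq> reps - a ` K"
    and K: "M \<le> 3 * card K"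
  shows "rare (\<lambda>S. 3 * card {k \<in> K. (a k \<in> S) \<noteq> (b k \<in> S)} \<le> card K)"
proof -
  let ?P = "\<lambda>S. 3 * card {k \<in> K. (a k \<in> S) \<noteq> (b k \<in> S)} \<le> card K"
  have "{k \<in> K. (a k \<in> S) \<noteq> (b k \<in> S)} = {k \<in> K. (a k \<in> S \<inter> reps) \<noteq> (b k \<in> S \<inter> reps)}" for S
    using a b by blast
  then have "card {S. inverse_closed R S \<and> ?P S} = card {W \<in> Pow reps. ?P W}"
    by (intro card_inverse_closed_via_reps) simp
  then have "real (card {S. inverse_closed R S \<and> ?P S}) \<le> 2 powr (real (card reps) - real (card K) / 15)"
    using card_few_disagreements_le[OF finite_reps inj a b] by simp
  also have "\<dots> \<le> 2 powr (5 * real M - real M / 64)"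
    using K by (intro powr_mono) (auto simp: card_reps)
  finally show ?thesis unfolding rare_def .
qed

lemma translation_transversal:
  assumes "h \<in> carrier E" "h \<noteq> \<one>"
  obtains J where "J \<subseteq> carrier E" "\<forall>g\<in>J. h \<otimes> g \<notin> J" "M = 2 * card J"
proof -
  obtain J where "J \<subseteq> carrier E" "J \<inter> (\<lambda>g. h \<otimes> g) ` J = {}" "M = 2 * card J"
  proof (rule involution_transversal[of "carrier E" "\<lambda>g. h \<otimes> g"])
    show "h \<otimes> g \<noteq> g" if "g \<in> carrier E" for g
      using assms that by (metis cancel2' m_comm sq)
  qed (use assms fin in auto)
  with that show thesis by blast
qed

text \<open>
  Only cosets other than that of the two vertices are used.  For each of the three non-central
  cosets, let \<open>g\<close> run through a transversal \<open>J\<close> of the involution \<open>g \<mapsto> h \<otimes> g\<close>, where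
  \<open>h = e \<otimes> f\<close>.  Whenever \<open>S\<close> contains only one of the two elements with
  coordinates \<open>g\<close> and \<open>h \<otimes> g\<close>, four vertices distinguish the two given ones: two
  positions, each with both signs.
\<close>
lemma rare_close_same_unit:
  assumes e: "e \<in> carrier E" and f: "f \<in> carrier E" and ne: "e \<noteq> f"
  shows "rare (\<lambda>S. card (nbr_diff S ((s, u), e) ((t, u), f)) \<le> 2 * M)"
proof -
  define h where "h = e \<otimes> f"
  have h: "h \<in> carrier E" "h \<noteq> \<one>" using e f ne mult_eq_one_iff by (auto simp: h_def)
  obtain J where J: "J \<subseteq> carrier E" "\<forall>g\<in>J. h \<otimes> g \<notin> J" "M = 2 * card J"
    by (rule translation_transversal[OF h])
  have JE: "g \<in> carrier E" if "g \<in> J" for g using that J(1) by blast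
  have finJ: "finite J" using J(1) fin finite_subset by blast
  let ?K = "{UI, UJ, UK} \<times> J"
  let ?a = "\<lambda>(w, g). ((False, w), g)" and ?b = "\<lambda>(w, g). ((False, w), h \<otimes> g)"
  have rel: "f \<otimes> (e \<otimes> g) = h \<otimes> g" "e \<otimes> (f \<otimes> g) = h \<otimes> g" if "g \<in> carrier E" for g
    using e f that by (simp_all add: h_def m_ac)
  have cardK: "card ?K = 3 * card J" by (simp add: card_cartesian_product)
  show ?thesis
  proof (rule rare_mono[OF rare_few_disagreements[of ?a ?K ?b]])
    show "inj_on ?a ?K" by (auto simp: inj_on_def)
    show "?a ` ?K \<subseteq> reps" using JE by (auto simp: reps_iff)
    show "?b ` ?K \<subseteq> reps - ?a ` ?K" using JE J(2) h(1) by (auto simp: reps_iff)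
    show "M \<le> 3 * card ?K" using J(3) cardK by simp
    fix S assume le: "card (nbr_diff S ((s, u), e) ((t, u), f)) \<le> 2 * M"
    let ?D = "{k \<in> ?K. (?a k \<in> S) \<noteq> (?b k \<in> S)}"
    let ?\<iota> = "\<lambda>((w, g), r :: bool, c :: bool). ((r, klein u w), (if c then e else f) \<otimes> g)"
    have "inj_on ?\<iota> (?D \<times> (UNIV :: bool set) \<times> (UNIV :: bool set))"
    proof (rule inj_onI)
      fix k k' assume k: "k \<in> ?D \<times> UNIV \<times> UNIV" "k' \<in> ?D \<times> UNIV \<times> UNIV" and eq: "?\<iota> k = ?\<iota> k'"
      obtain w g r c w' g' r' c' where kk: "k = ((w, g), r, c)" "k' = ((w', g'), r', c')"
        by (metis surj_pair)
      have g: "g \<in> J" "g' \<in> J" using k unfolding kk by auto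
      have "klein u w = klein u w'" "r = r'" using eq by (simp_all add: kk)
      then have w: "w = w'" by (metis klein_cancel)
      have eg: "(if c then e else f) \<otimes> g = (if c' then e else f) \<otimes> g'" using eq by (simp add: kk)
      have "c = c'"
      proof (rule ccontr)
        assume "c \<noteq> c'"
        then have "e \<otimes> g = f \<otimes> g' \<or> e \<otimes> g' = f \<otimes> g" using eg by (cases c) auto
        then have "g' = h \<otimes> g \<or> g = h \<otimes> g'" using e f JE g rel by (metis cancel2)
        then show False using J(2) g by auto
      qed
      moreover from this eg have "g = g'" using e f JE g by (auto split: if_splits)
      ultimately show "k = k'" using \<open>r = r'\<close> w by (simp add: kk)
    qed
    moreover have "?\<iota> ` (?D \<times> UNIV \<times> UNIV) \<subseteq> nbr_diff S ((s, u), e) ((t, u), f)"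
    proof
      fix x assume "x \<in> ?\<iota> ` (?D \<times> UNIV \<times> UNIV)"
      then obtain w g r c where x: "x = ((r, klein u w), (if c then e else f) \<otimes> g)"
        and wg: "w \<in> {UI, UJ, UK}" "g \<in> J"
        and D: "(((False, w), g) \<in> S) \<noteq> (((False, w), h \<otimes> g) \<in> S)" by auto
      have "u \<noteq> klein u w" using wg(1) by (metis klein_cancel klein_self quat_unit.distinct(1,3,5) insertE emptyE)
      then show "x \<in> nbr_diff S ((s, u), e) ((t, u), f)"
        using D e f JE[OF wg(2)] rel unfolding nbr_diff_def x by (cases c) (auto simp: adj_diff_unit)
    qed
    moreover have "finite (nbr_diff S ((s, u), e) ((t, u), f))"
      unfolding nbr_diff_def using finite_C by simp
    ultimately have "card (?D \<times> (UNIV :: bool set) \<times> (UNIV :: bool set)) \<le> card (nbr_diff S ((s, u), e) ((t, u), f))"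
      by (rule card_inj_on_le)
    then have "4 * card ?D \<le> 2 * M"
      using le by (simp add: card_cartesian_product del: UNIV_Times_UNIV)
    then show "3 * card ?D \<le> card ?K" using J(3) cardK by simp
  qed
qed

text \<open>
  In the cosets of the two vertices, distinguishing vertices come from comparing the central part
  of \<open>S\<close> with a translate of its part in the coset \<open>w = klein u v\<close>; in the other cosets, from
  comparing the parts of \<open>S\<close> in the two cosets \<open>a\<close> and \<open>b\<close> with labels different from \<open>U1\<close> and \<open>w\<close>.  Each of the
  \<open>3 M\<close> comparisons yields two distinguishing vertices.
\<close>
lemma rare_close_diff_unit:
  assumes e: "e \<in> carrier E" and f: "f \<in> carrier E" and ne: "u \<noteq> v"
  shows "rare (\<lambda>S. card (nbr_diff S ((s, u), e) ((t, v), f)) \<le> 2 * M)"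
proof -
  define h where "h = e \<otimes> f"
  have h: "h \<in> carrier E" using e f by (simp add: h_def)
  define w where "w = klein u v"
  have w1: "w \<noteq> U1" using ne by (simp add: w_def)
  obtain a where a: "a \<noteq> U1" "a \<noteq> w"
  proof (cases "w = UI")
    case True
    then show thesis using that[of UJ] by simp
  next
    case False
    then show thesis using that[of UI] by simp
  qed
  define b where "b = klein w a"
  have b: "b \<noteq> U1" "b \<noteq> w" "b \<noteq> a" 
    unfolding b_def using a w1 by (cases w; cases a; simp add: klein_def)+
  let ?K = "{(False, U1), (True, U1), (False, a)} \<times> carrier E"
  let ?b = "\<lambda>(q, g). ((False, if snd q = U1 then w else b), h \<otimes> g)"
  have rel: "f \<otimes> (e \<otimes> g) = h \<otimes> g" "e \<otimes> (f \<otimes> g) = h \<otimes> g" if "g \<in> carrier E" for g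
    using e f that by (simp_all add: h_def m_ac)
  have vu: "klein v u = w" by (simp add: w_def klein_comm)
  have vua: "klein v (klein u a) = b" by (simp add: b_def klein_assoc [symmetric] vu)
  have ua: "u \<noteq> klein u a" "v \<noteq> klein u a" 
    using a by (metis klein_cancel klein_self, metis klein_cancel w_def)
  have cardK: "card ?K = 3 * M" using a by (simp add: card_cartesian_product)
  show ?thesis
  proof (rule rare_mono[OF rare_few_disagreements[of "\<lambda>k. k" ?K ?b]])
    show "inj_on (\<lambda>k. k) ?K" by simp
    show "(\<lambda>k. k) ` ?K \<subseteq> reps" by (auto simp: reps_iff)
    show "?b ` ?K \<subseteq> reps - (\<lambda>k. k) ` ?K" using a b w1 h by (auto simp: reps_iff)
    show "M \<le> 3 * card ?K" using cardK by simp
    fix S assume le: "card (nbr_diff S ((s, u), e) ((t, v), f)) \<le> 2 * M"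
    let ?D = "{k \<in> ?K. (k \<in> S) \<noteq> (?b k \<in> S)}"
    let ?\<iota> = "\<lambda>((q, g), c). if snd q = U1
        then (if c then ((s \<noteq> fst q, u), e \<otimes> g) else ((t \<noteq> fst q, v), f \<otimes> g))
        else ((c, klein u a), e \<otimes> g)"
    have "inj_on ?\<iota> (?D \<times> (UNIV :: bool set))"
      unfolding inj_on_def using e f ne ua by (auto split: if_splits)
    moreover have "?\<iota> ` (?D \<times> UNIV) \<subseteq> nbr_diff S ((s, u), e) ((t, v), f)"
    proof
      fix x assume "x \<in> ?\<iota> ` (?D \<times> UNIV)"
      then obtain q g c where x: "x = ?\<iota> ((q, g), c)" and k: "(q, g) \<in> ?D" by auto
      have g: "g \<in> carrier E" using k by auto
      show "x \<in> nbr_diff S ((s, u), e) ((t, v), f)"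
      proof (cases "snd q = U1")
        case True
        then obtain r where q: "q = (r, U1)" by (metis prod.collapse)
        have "(((r, U1), g) \<in> S) \<noteq> (((False, w), h \<otimes> g) \<in> S)" using k q by simp
        moreover have "(s \<noteq> (s \<noteq> r)) = r" "(t \<noteq> (t \<noteq> r)) = r" by auto
        ultimately show ?thesis using e f g rel ne unfolding x q
          by (cases c) (simp_all add: nbr_diff_def adj_same_unit adj_diff_unit vu w_def [symmetric])
      next
        case False
        then have q: "q = (False, a)" using k by auto
        have "(((False, a), g) \<in> S) \<noteq> (((False, b), h \<otimes> g) \<in> S)" using k q a by simp
        then show ?thesis using e f g rel a ua unfolding x q
          by (simp add: nbr_diff_def adj_diff_unit vua)
      qed
    qed
    moreover have "finite (nbr_diff S ((s, u), e) ((t, v), f))"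
      unfolding nbr_diff_def using finite_C by simp
    ultimately have "card (?D \<times> (UNIV :: bool set)) \<le> card (nbr_diff S ((s, u), e) ((t, v), f))"
      by (rule card_inj_on_le)
    then have "2 * card ?D \<le> 2 * M" using le by (simp add: card_cartesian_product)
    then show "3 * card ?D \<le> card ?K" using cardK by simp
  qed
qed

lemma rare_close:
  assumes x: "x \<in> C" and y: "y \<in> C" and ne: "y \<noteq> x" "y \<noteq> neg x"
  shows "rare (\<lambda>S. card (nbr_diff S x y) \<le> 2 * M)"
proof -
  obtain s u e t v f where xy: "x = ((s, u), e)" "y = ((t, v), f)" by (metis surj_pair)
  have ef: "e \<in> carrier E" "f \<in> carrier E" using x y xy by auto
  show ?thesis
  proof (cases "u = v")
    case True
    then have "e \<noteq> f" using ne xy by auto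
    then show ?thesis using rare_close_same_unit[OF ef] True xy by simp
  next
    case False
    then show ?thesis using rare_close_diff_unit[OF ef] xy by simp
  qed
qed

text \<open>
  The indices \<open>f\<close> at which the central elements \<open>f\<close> and \<open>-f\<close> disagree form a set that contains no orbit of \<open>f \<mapsto> e \<otimes> f\<close>.
\<close>
lemma rare_unlinked:
  assumes e: "e \<in> carrier E" "e \<noteq> \<one>"
  shows "rare (\<lambda>S. \<forall>f\<in>carrier E. \<not> (split_at S f \<and> split_at S (e \<otimes> f)))"
proof -
  let ?E = "carrier E"
  let ?P = "\<lambda>S. \<forall>f\<in>?E. \<not> (split_at S f \<and> split_at S (e \<otimes> f))"
  let ?Q = "{D. D \<subseteq> ?E \<and> (\<forall>f\<in>?E. \<not> (f \<in> D \<and> e \<otimes> f \<in> D))}"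
  let ?a = "\<lambda>f. ((False, U1), f)" and ?b = "\<lambda>f. ((True, U1), f)"
  have "?P S \<longleftrightarrow> ?P (S \<inter> reps)" for S using e by (auto simp: split_at_def reps_iff)
  then have "card {S. inverse_closed R S \<and> ?P S} = card {W \<in> Pow reps. ?P W}"
    by (intro card_inverse_closed_via_reps)
  also have "{W \<in> Pow reps. ?P W} = {W \<in> Pow reps. {f \<in> ?E. (?a f \<in> W) \<noteq> (?b f \<in> W)} \<in> ?Q}"
    using e by (auto simp: split_at_def)
  also have "card \<dots> \<le> 2 ^ (card reps - M) * card ?Q"
    by (rule card_agreement_pattern_le[OF finite_reps]) (auto simp: inj_on_def reps_iff)
  finally have "real (card {S. inverse_closed R S \<and> ?P S}) \<le> real (2 ^ (card reps - M) * card ?Q)"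
    by (rule of_nat_mono)
  also have "\<dots> = 2 powr (4 * real M) * real (card ?Q)"
    using powr_realpow[of 2 "4 * M"] by (simp add: card_reps)
  also have "\<dots> \<le> 2 powr (4 * real M) * 2 powr (4/5 * real M)"
  proof (intro mult_left_mono card_involution_avoiding_le fin)
    show "e \<otimes> g \<noteq> g" if "g \<in> ?E" for g
      using e that by (metis cancel2' m_comm sq)
  qed (use e in auto)
  also have "\<dots> \<le> 2 powr (5 * real M - real M / 64)"
    by (simp add: powr_add [symmetric])
  finally show ?thesis unfolding rare_def .
qed

text \<open>
  The fixed points of \<open>L\<close> form a proper subgroup, so \<open>L\<close> moves at least half of the centre, and a
  third of these points can be compared independently with their images.
\<close>
lemma rare_symmetric:
  assumes L: "L permutes carrier sgnE" "sgn.additive L" "L \<noteq> id"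
  shows "rare (\<lambda>S. \<forall>z\<in>carrier sgnE. ((fst (L z), U1), snd (L z)) \<in> S \<longleftrightarrow> ((fst z, U1), snd z) \<in> S)"
proof -
  define Z where "Z = carrier sgnE"
  have cardZ: "card Z = 2 * M" by (simp add: Z_def card_cartesian_product)
  have finZ: "finite Z" unfolding Z_def by (rule sgn.fin)
  have LZ: "L z \<in> Z" if "z \<in> Z" for z using permutes_in_image[OF L(1)] that by (simp add: Z_def)
  let ?F = "{z \<in> Z. L z \<noteq> z}"
  obtain z0 where z0: "z0 \<in> ?F"
    using L(1,3) permutes_not_in[OF L(1)] unfolding Z_def by fastforce
  have "card (Z - ?F) \<le> card ?F"
  proof (rule card_inj_on_le[of "\<lambda>z. z0 \<otimes>\<^bsub>sgnE\<^esub> z"])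
    show "inj_on (\<lambda>z. z0 \<otimes>\<^bsub>sgnE\<^esub> z) (Z - ?F)"
    proof (rule inj_onI)
      fix x y assume "x \<in> Z - ?F" "y \<in> Z - ?F" and eq: "z0 \<otimes>\<^bsub>sgnE\<^esub> x = z0 \<otimes>\<^bsub>sgnE\<^esub> y"
      then have "x \<in> carrier sgnE" "y \<in> carrier sgnE" "z0 \<in> carrier sgnE"
        using z0 unfolding Z_def by blast+
      then show "x = y" using eq sgn.cancel2 by metis
    qed
    show "(\<lambda>z. z0 \<otimes>\<^bsub>sgnE\<^esub> z) ` (Z - ?F) \<subseteq> ?F"
    proof
      fix y assume "y \<in> (\<lambda>z. z0 \<otimes>\<^bsub>sgnE\<^esub> z) ` (Z - ?F)"
      then obtain z where z: "z \<in> Z" "L z = z" "y = z0 \<otimes>\<^bsub>sgnE\<^esub> z" by blast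
      have car: "z \<in> carrier sgnE" "z0 \<in> carrier sgnE" "L z0 \<in> carrier sgnE"
        using z(1) z0 LZ[of z0] unfolding Z_def by blast+
      have "L (z0 \<otimes>\<^bsub>sgnE\<^esub> z) = L z0 \<otimes>\<^bsub>sgnE\<^esub> L z"
        using L(2) car unfolding sgn.additive_def by blast
      then have "L y = L z0 \<otimes>\<^bsub>sgnE\<^esub> z" by (simp only: z(2,3))
      moreover have "L z0 \<otimes>\<^bsub>sgnE\<^esub> z \<noteq> z0 \<otimes>\<^bsub>sgnE\<^esub> z"
        using sgn.right_cancel[OF car(1,3,2)] z0 by blast
      ultimately have "L y \<noteq> y" using z(3) by metis
      moreover have "y \<in> Z" using z z0 unfolding Z_def by blast
      ultimately show "y \<in> ?F" by simp
    qed
  qed (use finZ in simp)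
  moreover have "card (Z - ?F) = card Z - card ?F" using finZ by (intro card_Diff_subset) auto
  ultimately have F: "M \<le> card ?F" using cardZ by simp
  obtain K where K: "K \<subseteq> ?F" "K \<inter> L ` K = {}" "card ?F \<le> 3 * card K"
  proof (rule independent_subset[of ?F L])
    show "L ` ?F \<subseteq> ?F" using LZ permutes_inj[OF L(1)] by (auto dest: injD)
    show "inj_on L ?F" by (rule permutes_inj_on[OF L(1)])
  qed (use finZ in auto)
  let ?a = "\<lambda>z. ((fst z, U1), snd z)"
  show ?thesis
  proof (rule rare_mono[OF rare_few_disagreements[of ?a K "\<lambda>z. ?a (L z)"]])
    show "inj_on ?a K" by (auto simp: inj_on_def)
    show "?a ` K \<subseteq> reps" using K(1) by (auto simp: reps_iff Z_def)
    have in_reps: "?a (L z) \<in> reps" if "z \<in> K" for z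
      using K(1) that LZ[of z] by (cases "L z") (auto simp: reps_iff Z_def)
    have ne: "?a (L z) \<noteq> ?a y" if "z \<in> K" "y \<in> K" for y z
    proof -
      have "L z \<noteq> y" using K(2) that by blast
      then show ?thesis by (auto simp: prod_eq_iff)
    qed
    show "(\<lambda>z. ?a (L z)) ` K \<subseteq> reps - ?a ` K"
    proof (rule image_subsetI)
      fix z assume z: "z \<in> K"
      have "?a (L z) \<notin> ?a ` K"
      proof
        assume "?a (L z) \<in> ?a ` K"
        then obtain y where "?a (L z) = ?a y" "y \<in> K" by (rule imageE)
        with ne[OF z] show False by blast
      qed
      with in_reps[OF z] show "?a (L z) \<in> reps - ?a ` K" by (rule DiffI)
    qed
    show "M \<le> 3 * card K" using F K(3) by simp
    fix S assume sym: "\<forall>z\<in>carrier sgnE. ?a (L z) \<in> S \<longleftrightarrow> ?a z \<in> S"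
    have "{z \<in> K. (?a z \<in> S) \<noteq> (?a (L z) \<in> S)} = {}"
      using sym K(1) unfolding Z_def by blast
    then show "3 * card {z \<in> K. (?a z \<in> S) \<noteq> (?a (L z) \<in> S)} \<le> card K" by (metis card.empty mult_0_right zero_le)
  qed
qed

lemma rare_periodic:
  assumes e: "e \<in> carrier E" and uv: "u \<noteq> U1" "v \<noteq> U1" and ne: "u \<noteq> v \<or> e \<noteq> \<one>"
  shows "rare (\<lambda>S. \<forall>g\<in>carrier E. ((False, u), g) \<in> S \<longleftrightarrow> ((False, v), e \<otimes> g) \<in> S)"
proof -
  obtain J where J: "J \<subseteq> carrier E" "u = v \<longrightarrow> (\<forall>g\<in>J. e \<otimes> g \<notin> J)" "M \<le> 3 * card J"
  proof (cases "u = v")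
    case True
    with ne have "e \<noteq> \<one>" by simp
    from translation_transversal[OF e this] obtain J
      where "J \<subseteq> carrier E" "\<forall>g\<in>J. e \<otimes> g \<notin> J" "M = 2 * card J" .
    then show thesis using that[of J] by simp
  next
    case False
    then show thesis using that[of "carrier E"] by simp
  qed
  let ?a = "\<lambda>g. ((False, u), g)" and ?b = "\<lambda>g. ((False, v), e \<otimes> g)"
  show ?thesis
  proof (rule rare_mono[OF rare_few_disagreements[of ?a J ?b]])
    show "inj_on ?a J" by (simp add: inj_on_def)
    show "?a ` J \<subseteq> reps" using J(1) by (auto simp: reps_iff)
    show "?b ` J \<subseteq> reps - ?a ` J" using J(1,2) e by (auto simp: reps_iff)
    show "M \<le> 3 * card J" by (rule J(3))
    fix S assume "\<forall>g\<in>carrier E. ?a g \<in> S \<longleftrightarrow> ?b g \<in> S"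
    then have "{g \<in> J. (?a g \<in> S) \<noteq> (?b g \<in> S)} = {}" using J(1) by blast
    then show "3 * card {g \<in> J. (?a g \<in> S) \<noteq> (?b g \<in> S)} \<le> card J" by (metis card.empty mult_0_right zero_le)
  qed
qed

lemma card_UN_rare_le:
  assumes fin: "finite I" and rare: "\<And>i. i \<in> I \<Longrightarrow> rare (P i)"
    and bad: "\<And>S. inverse_closed R S \<Longrightarrow> Q S \<Longrightarrow> \<exists>i\<in>I. P i S"
  shows "real (card {S. inverse_closed R S \<and> Q S}) \<le> real (card I) * 2 powr (5 * real M - real M / 64)"
proof -
  let ?A = "\<lambda>i. {S. inverse_closed R S \<and> P i S}"
  have finA: "finite (?A i)" for i using finite_inverse_closed by (rule rev_finite_subset) auto
  have "card {S. inverse_closed R S \<and> Q S} \<le> card (\<Union>i\<in>I. ?A i)"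
    using bad fin finA by (intro card_mono) auto
  also have "\<dots> \<le> (\<Sum>i\<in>I. card (?A i))" using fin by (rule card_UN_le)
  finally have "real (card {S. inverse_closed R S \<and> Q S}) \<le> (\<Sum>i\<in>I. real (card (?A i)))"
    using of_nat_mono by fastforce
  also have "\<dots> \<le> (\<Sum>i\<in>I. 2 powr (5 * real M - real M / 64))"
    using rare unfolding rare_def by (intro sum_mono) auto
  finally show ?thesis by simp
qed

text \<open>
  The union bound over all pairs of vertices, all elements of \<open>E\<close>, all additive permutations of the
  centre, and all candidates for a period or translation; here \<open>l + 3\<close> is \<open>log n\<close>.
\<close>
theorem card_exceptional_le:
  assumes M: "M = 2 ^ l"
  shows "real (card {S. inverse_closed R S \<and> Bgrp E \<subset> Aut (Cay R S)})
    \<le> 2 powr (5 * real M - real M / 64 + (real l + 3)\<^sup>2 + 2)"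
proof -
  let ?B = "2 powr (5 * real M - real M / 64)"
  let ?c = "\<lambda>Q. real (card {S. inverse_closed R S \<and> Q S})"
  let ?I1 = "{(x, y) \<in> C \<times> C. y \<noteq> x \<and> y \<noteq> neg x}"
  let ?I2 = "{e \<in> carrier E. e \<noteq> \<one>}"
  let ?I3 = "{L. L permutes carrier sgnE \<and> sgn.additive L \<and> L \<noteq> id}"
  let ?U = "{UI, UJ, UK}"
  let ?I4 = "{(u, v, e) \<in> ?U \<times> ?U \<times> carrier E. u \<noteq> v \<or> e \<noteq> \<one>}"
  have cardC: "card C = 8 * M"
    using order_Q8 by (simp add: card_cartesian_product order_def)
  have b1: "?c (\<lambda>S. \<not> separated S) \<le> real (card ?I1) * ?B"
  proof (rule card_UN_rare_le[where P = "\<lambda>(x, y) S. card (nbr_diff S x y) \<le> 2 * M"])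
    show "finite ?I1" using finite_C by (intro finite_subset[of ?I1 "C \<times> C"]) auto
    show "rare ((\<lambda>(x, y) S. card (nbr_diff S x y) \<le> 2 * M) i)" if "i \<in> ?I1" for i
    proof -
      obtain x y where i: "i = (x, y)" by (cases i)
      have "x \<in> C" "y \<in> C" "y \<noteq> x" "y \<noteq> neg x" using that unfolding i by blast+
      then show ?thesis unfolding i prod.case by (rule rare_close)
    qed
    show "\<exists>i\<in>?I1. (\<lambda>(x, y) S. card (nbr_diff S x y) \<le> 2 * M) i S" if "\<not> separated S" for S
    proof -
      from that obtain x y where "x \<in> C" "y \<in> C" "y \<noteq> x" "y \<noteq> neg x"
        and le: "card (nbr_diff S x y) \<le> 2 * M"
        unfolding separated_def not_less [symmetric] by blast
      then have "(x, y) \<in> ?I1" by blast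
      with le show ?thesis by (intro bexI[of _ "(x, y)"]) simp_all
    qed
  qed
  have b2: "?c (\<lambda>S. \<not> linked S) \<le> real (card ?I2) * ?B"
    by (rule card_UN_rare_le[where P = "\<lambda>e S. \<forall>f\<in>carrier E. \<not> (split_at S f \<and> split_at S (e \<otimes> f))"])
      (use rare_unlinked fin in \<open>auto simp: linked_def\<close>)
  have finI3: "finite {L. L permutes carrier sgnE \<and> sgn.additive L}"
    using finite_permutations[OF sgn.fin] by (rule rev_finite_subset) auto
  have b3: "?c (\<lambda>S. \<not> rigid S) \<le> real (card ?I3) * ?B"
  proof (rule card_UN_rare_le)
    show "finite ?I3" using finI3 by (rule rev_finite_subset) auto
    show "rare (\<lambda>S. \<forall>z\<in>carrier sgnE. ((fst (L z), U1), snd (L z)) \<in> S \<longleftrightarrow> ((fst z, U1), snd z) \<in> S)"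
      if "L \<in> ?I3" for L using that rare_symmetric by blast
    show "\<exists>L\<in>?I3. \<forall>z\<in>carrier sgnE. ((fst (L z), U1), snd (L z)) \<in> S \<longleftrightarrow> ((fst z, U1), snd z) \<in> S"
      if "\<not> rigid S" for S using that unfolding rigid_def by blast
  qed
  have b4: "?c (\<lambda>S. \<not> aperiodic S) \<le> real (card ?I4) * ?B"
  proof (rule card_UN_rare_le[where P = "\<lambda>(u, v, e) S. \<forall>g\<in>carrier E. ((False, u), g) \<in> S \<longleftrightarrow> ((False, v), e \<otimes> g) \<in> S"])
    show "finite ?I4" using fin by (intro finite_subset[of ?I4 "?U \<times> ?U \<times> carrier E"]) auto
    show "rare ((\<lambda>(u, v, e) S. \<forall>g\<in>carrier E. ((False, u), g) \<in> S \<longleftrightarrow> ((False, v), e \<otimes> g) \<in> S) i)"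
      if i: "i \<in> ?I4" for i
    proof -
      obtain u v e where "i = (u, v, e)" by (metis surj_pair)
      then show ?thesis using i rare_periodic[of e u v] by auto
    qed
    have U: "u \<in> ?U" if "u \<noteq> U1" for u using that by (cases u) auto
    show "\<exists>i\<in>?I4. (\<lambda>(u, v, e) S. \<forall>g\<in>carrier E. ((False, u), g) \<in> S \<longleftrightarrow> ((False, v), e \<otimes> g) \<in> S) i S"
      if "\<not> aperiodic S" for S
    proof -
      from that obtain u v e where "e \<in> carrier E" "u \<noteq> U1" "v \<noteq> U1" "\<not> (u = v \<and> e = \<one>)"
        and "\<forall>g\<in>carrier E. ((False, u), g) \<in> S \<longleftrightarrow> ((False, v), e \<otimes> g) \<in> S"
        unfolding aperiodic_def by blast
      then show ?thesis using U by (intro bexI[of _ "(u, v, e)"]) auto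
    qed
  qed
  have c1: "card ?I1 \<le> 64 * M * M"
  proof -
    have "card ?I1 \<le> card (C \<times> C)" using finite_C by (intro card_mono) auto
    also have "\<dots> = card C * card C" by (rule card_cartesian_product)
    finally show ?thesis unfolding cardC by simp
  qed
  have c2: "card ?I2 \<le> M" using fin by (intro card_mono) auto
  have c3: "card ?I3 \<le> 2 ^ ((l + 1) * (l + 1))"
  proof -
    have "card ?I3 \<le> card {L. L permutes carrier sgnE \<and> sgn.additive L}"
      using finI3 by (intro card_mono) auto
    also have "\<dots> \<le> 2 ^ ((l + 1) * (l + 1))"
      by (rule sgn.card_additive_le) (simp add: card_cartesian_product M)
    finally show ?thesis .
  qed
  have c4: "card ?I4 \<le> 9 * M"
  proof -
    have "card ?I4 \<le> card (?U \<times> ?U \<times> carrier E)" using fin by (intro card_mono) auto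
    then show ?thesis by (simp add: card_cartesian_product)
  qed
  have split: "{S. inverse_closed R S \<and> Bgrp E \<subset> Aut (Cay R S)} \<subseteq>
      {S. inverse_closed R S \<and> \<not> separated S} \<union> {S. inverse_closed R S \<and> \<not> linked S} \<union>
      {S. inverse_closed R S \<and> \<not> rigid S} \<union> {S. inverse_closed R S \<and> \<not> aperiodic S}" (is "?X \<subseteq> ?Y")
    using Aut_subset_Bgrp by blast
  have finY: "finite ?Y" using finite_inverse_closed by (rule rev_finite_subset) auto
  have un4: "card (A1 \<union> A2 \<union> A3 \<union> A4) \<le> card A1 + card A2 + card A3 + card A4"
    for A1 A2 A3 A4 :: "(quat \<times> 'a) set set"
    using card_Un_le[of "A1 \<union> A2 \<union> A3" A4] card_Un_le[of "A1 \<union> A2" A3] card_Un_le[of A1 A2] by linarith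
  have "card ?X \<le> card {S. inverse_closed R S \<and> \<not> separated S} + card {S. inverse_closed R S \<and> \<not> linked S} +
      card {S. inverse_closed R S \<and> \<not> rigid S} + card {S. inverse_closed R S \<and> \<not> aperiodic S}"
    using card_mono[OF finY split] un4 by (rule le_trans)
  then have "real (card ?X) \<le> ?c (\<lambda>S. \<not> separated S) + ?c (\<lambda>S. \<not> linked S) + ?c (\<lambda>S. \<not> rigid S) + ?c (\<lambda>S. \<not> aperiodic S)"
    by linarith
  also have "\<dots> \<le> real (card ?I1 + card ?I2 + card ?I3 + card ?I4) * ?B"
    using b1 b2 b3 b4 by (simp add: algebra_simps)
  also have "\<dots> \<le> real (2 ^ ((l + 3) * (l + 3) + 2)) * ?B"
  proof (rule mult_right_mono)
    have "card ?I1 + card ?I2 + card ?I3 + card ?I4 \<le> 64 * M * M + M + 2 ^ ((l + 1) * (l + 1)) + 9 * M"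
      using c1 c2 c3 c4 by linarith
    also have "64 * M * M = 2 ^ (2 * l + 6)"
      unfolding M power_add mult_2 [of l] by simp
    also have "2 ^ (2 * l + 6) + M + 2 ^ ((l + 1) * (l + 1)) + 9 * M
        \<le> 2 ^ (2 * l + 6) + 2 ^ ((l + 1) * (l + 1)) + 2 ^ (l + 4)"
      unfolding M by (simp add: power_add)
    also have "\<dots> \<le> 2 ^ ((l + 3) * (l + 3)) + 2 ^ ((l + 3) * (l + 3)) + 2 ^ ((l + 3) * (l + 3))"
      by (intro add_mono power_increasing) (auto simp: algebra_simps)
    also have "\<dots> \<le> 2 ^ ((l + 3) * (l + 3) + 2)" by (simp add: power_add)
    finally show "real (card ?I1 + card ?I2 + card ?I3 + card ?I4) \<le> real (2 ^ ((l + 3) * (l + 3) + 2))"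
      by (rule of_nat_mono)
  qed simp
  also have "\<dots> = 2 powr (real ((l + 3) * (l + 3) + 2)) * ?B" 
    using powr_realpow[of 2 "(l + 3) * (l + 3) + 2"] by simp
  also have "\<dots> = 2 powr (5 * real M - real M / 64 + (real l + 3)\<^sup>2 + 2)"
    by (simp add: powr_add [symmetric] power2_eq_square algebra_simps)
  finally show ?thesis .
qed

end

theorem theorem1p6:
  fixes E :: "('a, 'b) monoid_scheme"
    and R :: "(quat \<times> 'a) monoid"
    and n :: nat
    and B :: "(quat \<times> 'a \<Rightarrow> quat \<times> 'a) set"
    and \<epsilon> :: real
  assumes "elementary_abelian_2_group E"
    and "R = Q8 \<times>\<times> E"
    and "n = order R"
    and "B = Bgrp E"
    and "\<epsilon> = 2 powr (- (real n / 512) + (log 2 (real n))\<^sup>2 + 2)"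
  shows "(\<exists>l::nat. R \<cong> Q8 \<times>\<times> product_group {..<l} (\<lambda>_. integer_mod_group 2))
    \<and> real (card {S. inverse_closed R S}) = 2 powr (5 * real n / 8)
    \<and> real (card {S. inverse_closed R S \<and> B \<subset> Aut (Cay R S)}) \<le> 2 powr (5 * real n / 8) * \<epsilon>"
proof -
  interpret elem2 E using assms(1) by (simp add: elem2_iff)
  interpret quat_times_elem2 E ..
  obtain l b where b: "b \<in> {..<l} \<rightarrow> carrier E" and iso: "comb b l \<in> iso (bits l) E"
    by (rule basis_exists)
  have M: "card (carrier E) = 2 ^ l"
    using iso card_bits bij_betw_same_card unfolding iso_def by force
  have n: "n = 8 * 2 ^ l"
    using order_Q8 M by (simp add: assms(2,3) order_def card_cartesian_product)
  have "E \<cong> bits l"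
    using iso group.iso_sym[of "bits l" E] by (auto simp: is_iso_def)
  then have "R \<cong> Q8 \<times>\<times> bits l"
    unfolding assms(2) by (rule group.DirProd_iso_trans[OF group_Q8 iso_refl])
  moreover have "real (card {S. inverse_closed R S}) = 2 powr (5 * real n / 8)"
    unfolding assms(2) using powr_realpow[of 2 "5 * 2 ^ l"] by (simp add: card_inverse_closed M n)
  moreover have "real (card {S. inverse_closed R S \<and> B \<subset> Aut (Cay R S)}) \<le> 2 powr (5 * real n / 8) * \<epsilon>"
  proof -
    have "log 2 (real n) = real l + 3"
    proof -
      have "real n = 2 ^ (l + 3)" by (simp add: n power_add)
      then show ?thesis by (simp add: log_nat_power)
    qed
    then show ?thesis
      using card_exceptional_le[OF M] unfolding assms(2,4,5)
      by (simp add: n M powr_add [symmetric] algebra_simps)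
  qed
  ultimately show ?thesis by blast
qed

end
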